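(* Let $\Gamma$ be a group and $G=(V,E)$ a finite graph with a group action $\theta:\Gamma\to\mathrm{Aut}(G)$ that acts freely on $V$. Let $X\subseteq V$ with $\theta(\gamma)(X)=X$ for all $\gamma$, let $\tau:\Gamma\to O(\mathbb{R}^d)$ be a homomorphism and $\tilde\tau$ its augmented representation. Then the following are equivalent: (a) $G$ can be realised as a forced $\Gamma$-symmetric infinitesimally rigid bar-joint framework on $\mathbb{S}^d$ (with respect to $\theta$ and $\tilde\tau$) such that the points assigned to $X$ lie on the equator. (b) $G$ can be realised as a forced $\Gamma$-symmetric infinitesimally rigid point-hyperplane framework in $\mathbb{R}^d$ (with respect to $\theta$ and $\tau$) such that each vertex in $X$ is realised as a hyperplane and each vertex in $V\setminus X$ is realised as a point.
   Context: Write $\gamma i=\theta(\gamma)(i)$; $\tilde\tau(\gamma)=\begin{pmatrix}\tau(\gamma)&0\\0&1\end{pmatrix}$; the equator of $\mathbb{S}^d$ is $\mathbb{S}^d\cap\{x_{d+1}=0\}$. Spherical framework $(G,q)$ on $\mathbb{S}^d$: $q:V\to\mathbb{S}^d$ spanning $\mathbb{R}^{d+1}$; infinitesimal motions $\dot q:V\to\mathbb{R}^{d+1}$ satisfy $\langle q_i,\dot q_j\rangle+\langle q_j,\dot q_i\rangle=0$ ($\{i,j\}\in E$) and $\langle q_i,\dot q_i\rangle=0$ ($i\in V$); trivial motions are $\dot q_i=Sq_i$ with $S$ skew-symmetric. $(G,q)$ is $\Gamma$-symmetric if $\tilde\tau(\gamma)q(i)=q(\gamma i)$; a motion is $\Gamma$-symmetric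 if $\tilde\tau(\gamma)\dot q_i=\dot q_{\gamma i}$; forced $\Gamma$-symmetric infinitesimally rigid means every $\Gamma$-symmetric infinitesimal motion is trivial. Point-hyperplane framework $(G,p,\ell)$ in $\mathbb{R}^d$, $V=V_P\cup V_H$: $p:V_P\to\mathbb{R}^d$, $\ell=(a,r):V_H\to\mathbb{S}^{d-1}\times\mathbb{R}$ ($j\in V_H$ is the hyperplane $\{x:\langle a_j,x\rangle+r_j=0\}$), affinely spanning $\mathbb{R}^d$. Infinitesimal motions $(\dot p,\dot a,\dot r)$: $\langle p_i-p_j,\dot p_i-\dot p_j\rangle=0$ (point-point edges), $\langle p_i,\dot a_j\rangle+\langle\dot p_i,a_j\rangle+\dot r_j=0$ (edges $i\in V_P$, $j\in V_H$), $\langle a_i,\dot a_j\rangle+\langle\dot a_i,a_j\rangle=0$ (hyperplane-hyperplane edges), $\langle a_i,\dot a_i\rangle=0$ ($i\in V_H$); trivial motions are those induced by isometries of $\mathbb{R}^d$. $\Gamma$-symmetric (with $\theta$ preserving $V_P$ and $V_H$): $\tau(\gamma)p(i)=p(\gamma i)$, $\tau(\gamma)a(j)=\pm a(\gamma j)$, $r(j)=r(\gamma j)$; a motion is $\Gamma$-symmetric if it satisfies the same relations ($\tau(\gamma)\dot p_i=\dot p_{\gamma i}$, $\tau(\gamma)\dot a_j=\pm\dot a_{\gamma j}$ with the same sign, $\dot r_j=\dot r_{\gamma j}$); forced $\Gamma$-symmetric infinitesimally rigid means every $\Gamma$-symmetric infinitesimal motion is trivial.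
   Formalization: The sign in τ(γ)a(j)=±a(γj) also acts on r and on ṙ (r(j)=±r(γj), ṙ_j=±ṙ_{γj}, same sign), since the equivalence fails otherwise; "affinely spanning" means that the vectors (p_i,1) and (a_j,0) span R^{d+1}. *)

theory Defs
  imports "HOL-Analysis.Analysis" "HOL-Algebra.Bij"
begin

section \<open>Graphs, group actions and orthogonal representations\<close>

definition finite_graph :: "'v set \<Rightarrow> 'v set set \<Rightarrow> bool" where
  "finite_graph V E \<longleftrightarrow> finite V \<and> (\<forall>e\<in>E. e \<subseteq> V \<and> card e = 2)"

definition graph_aut :: "'v set \<Rightarrow> 'v set set \<Rightarrow> ('v \<Rightarrow> 'v) monoid" where
  "graph_aut V E =
     (BijGroup V)\<lparr>carrier := {f \<in> Bij V. \<forall>i\<in>V. \<forall>j\<in>V. {f i, f j} \<in> E \<longleftrightarrow> {i, j} \<in> E}\<rparr>"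

definition acts_freely :: "('g, 'm) monoid_scheme \<Rightarrow> ('g \<Rightarrow> 'v \<Rightarrow> 'v) \<Rightarrow> 'v set \<Rightarrow> bool" where
  "acts_freely \<Gamma> \<theta> V \<longleftrightarrow>
     (\<forall>\<gamma>\<in>carrier \<Gamma>. \<forall>i\<in>V. \<theta> \<gamma> i = i \<longrightarrow> \<gamma> = \<one>\<^bsub>\<Gamma>\<^esub>)"

definition orthogonal_group :: "('a::euclidean_space \<Rightarrow> 'a) monoid" where
  "orthogonal_group = \<lparr>carrier = {f. orthogonal_transformation f}, mult = (\<circ>), one = id\<rparr>"

text \<open>The space of dimension \<open>d + 1\<close> is \<open>(real ^ 'd) \<times> real\<close>, with the last coordinate as
  second component; its inner product is the Euclidean one. The map below is the block matrix
  with diagonal blocks \<open>\<tau> \<gamma>\<close> and \<open>1\<close>.\<close>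

definition augmented_rep :: "('g \<Rightarrow> 'a \<Rightarrow> 'a) \<Rightarrow> 'g \<Rightarrow> 'a \<times> real \<Rightarrow> 'a \<times> real" where
  "augmented_rep \<tau> \<gamma> = map_prod (\<tau> \<gamma>) id"

definition skew_symmetric :: "('a::euclidean_space \<Rightarrow> 'a) \<Rightarrow> bool" where
  "skew_symmetric S \<longleftrightarrow> linear S \<and> (\<forall>x y. S x \<bullet> y = - (x \<bullet> S y))"


section \<open>Spherical frameworks\<close>

definition equator :: "('a::euclidean_space \<times> real) set" where
  "equator = {x \<in> sphere 0 1. snd x = 0}"

definition spherical_framework :: "'v set \<Rightarrow> ('v \<Rightarrow> 'b::euclidean_space) \<Rightarrow> bool" where
  "spherical_framework V q \<longleftrightarrow> (\<forall>i\<in>V. q i \<in> sphere 0 1) \<and> span (q ` V) = UNIV"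

definition spherical_motion ::
  "'v set \<Rightarrow> 'v set set \<Rightarrow> ('v \<Rightarrow> 'b::euclidean_space) \<Rightarrow> ('v \<Rightarrow> 'b) \<Rightarrow> bool" where
  "spherical_motion V E q q' \<longleftrightarrow>
     (\<forall>i\<in>V. \<forall>j\<in>V. {i, j} \<in> E \<longrightarrow> q i \<bullet> q' j + q j \<bullet> q' i = 0) \<and>
     (\<forall>i\<in>V. q i \<bullet> q' i = 0)"

definition spherical_trivial_motion ::
  "'v set \<Rightarrow> ('v \<Rightarrow> 'b::euclidean_space) \<Rightarrow> ('v \<Rightarrow> 'b) \<Rightarrow> bool" where
  "spherical_trivial_motion V q q' \<longleftrightarrow>
     (\<exists>S. skew_symmetric S \<and> (\<forall>i\<in>V. q' i = S (q i)))"

text \<open>The same relation expresses symmetry of a framework and of a motion.\<close>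

definition spherical_symmetric ::
  "('g, 'm) monoid_scheme \<Rightarrow> ('g \<Rightarrow> 'v \<Rightarrow> 'v) \<Rightarrow> ('g \<Rightarrow> 'b \<Rightarrow> 'b) \<Rightarrow> 'v set \<Rightarrow> ('v \<Rightarrow> 'b) \<Rightarrow> bool"
  where
  "spherical_symmetric \<Gamma> \<theta> \<rho> V q \<longleftrightarrow> (\<forall>\<gamma>\<in>carrier \<Gamma>. \<forall>i\<in>V. \<rho> \<gamma> (q i) = q (\<theta> \<gamma> i))"

definition spherical_forced_rigid ::
  "('g, 'm) monoid_scheme \<Rightarrow> ('g \<Rightarrow> 'v \<Rightarrow> 'v) \<Rightarrow> ('g \<Rightarrow> 'b \<Rightarrow> 'b) \<Rightarrow>
   'v set \<Rightarrow> 'v set set \<Rightarrow> ('v \<Rightarrow> 'b::euclidean_space) \<Rightarrow> bool" where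
  "spherical_forced_rigid \<Gamma> \<theta> \<rho> V E q \<longleftrightarrow>
     (\<forall>q'. spherical_motion V E q q' \<and> spherical_symmetric \<Gamma> \<theta> \<rho> V q'
        \<longrightarrow> spherical_trivial_motion V q q')"


section \<open>Point-hyperplane frameworks\<close>

text \<open>The vertices in \<open>VP\<close> are points \<open>p i\<close>, those in \<open>VH\<close> are hyperplanes
  \<open>{x. a j \<bullet> x + r j = 0}\<close>. A hyperplane takes part in the affine span through its normal,
  i.e. as the ideal point \<open>(a j, 0)\<close> next to the affine points \<open>(p i, 1)\<close>: the smallest affine
  subspace through all \<open>p i\<close> whose direction space contains all \<open>a j\<close> is the whole space.
  In particular there is at least one point.\<close>

definition ph_framework ::
  "'v set \<Rightarrow> 'v set \<Rightarrow> ('v \<Rightarrow> 'a::euclidean_space) \<Rightarrow> ('v \<Rightarrow> 'a) \<Rightarrow> ('v \<Rightarrow> real) \<Rightarrow> bool" where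
  "ph_framework VP VH p a r \<longleftrightarrow>
     (\<forall>j\<in>VH. a j \<in> sphere 0 1) \<and>
     affine hull (p ` VP \<union> {p i + a j |i j. i \<in> VP \<and> j \<in> VH}) = UNIV"

definition ph_motion ::
  "'v set \<Rightarrow> 'v set \<Rightarrow> 'v set set \<Rightarrow> ('v \<Rightarrow> 'a::euclidean_space) \<Rightarrow> ('v \<Rightarrow> 'a) \<Rightarrow>
   ('v \<Rightarrow> 'a) \<Rightarrow> ('v \<Rightarrow> 'a) \<Rightarrow> ('v \<Rightarrow> real) \<Rightarrow> bool" where
  "ph_motion VP VH E p a p' a' r' \<longleftrightarrow>
     (\<forall>i\<in>VP. \<forall>j\<in>VP. {i, j} \<in> E \<longrightarrow> (p i - p j) \<bullet> (p' i - p' j) = 0) \<and>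
     (\<forall>i\<in>VP. \<forall>j\<in>VH. {i, j} \<in> E \<longrightarrow> p i \<bullet> a' j + p' i \<bullet> a j + r' j = 0) \<and>
     (\<forall>i\<in>VH. \<forall>j\<in>VH. {i, j} \<in> E \<longrightarrow> a i \<bullet> a' j + a' i \<bullet> a j = 0) \<and>
     (\<forall>i\<in>VH. a i \<bullet> a' i = 0)"

text \<open>An isometry \<open>x \<mapsto> R x + c\<close> carries the hyperplane with data \<open>(a, r)\<close> to the one with data
  \<open>(R a, r - R a \<bullet> c)\<close>. Differentiating a path of isometries through the identity, with
  velocity \<open>(S, t)\<close>, gives \<open>p' = S p + t\<close>, \<open>a' = S a\<close> and \<open>r' = - (a \<bullet> t)\<close>.\<close>

definition ph_trivial_motion ::
  "'v set \<Rightarrow> 'v set \<Rightarrow> ('v \<Rightarrow> 'a::euclidean_space) \<Rightarrow> ('v \<Rightarrow> 'a) \<Rightarrow>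
   ('v \<Rightarrow> 'a) \<Rightarrow> ('v \<Rightarrow> 'a) \<Rightarrow> ('v \<Rightarrow> real) \<Rightarrow> bool" where
  "ph_trivial_motion VP VH p a p' a' r' \<longleftrightarrow>
     (\<exists>S t. skew_symmetric S \<and>
        (\<forall>i\<in>VP. p' i = S (p i) + t) \<and>
        (\<forall>j\<in>VH. a' j = S (a j) \<and> r' j = - (a j \<bullet> t)))"

text \<open>As \<open>(a, r)\<close> and \<open>(- a, - r)\<close> describe the same hyperplane, the data are only compared up to
  a sign \<open>\<sigma> \<gamma> j\<close>, common to both components. The same relations, with the same signs, express
  symmetry of a framework and of a motion. A sign applied to \<open>a\<close> but not to \<open>r\<close> would be
  inconsistent: images under \<open>\<gamma>\<close> of point-hyperplane constraints would force \<open>r' j = 0\<close>.\<close>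

definition ph_symmetric ::
  "('g, 'm) monoid_scheme \<Rightarrow> ('g \<Rightarrow> 'v \<Rightarrow> 'v) \<Rightarrow> ('g \<Rightarrow> 'a \<Rightarrow> 'a) \<Rightarrow> ('g \<Rightarrow> 'v \<Rightarrow> real) \<Rightarrow>
   'v set \<Rightarrow> 'v set \<Rightarrow> ('v \<Rightarrow> 'a::euclidean_space) \<Rightarrow> ('v \<Rightarrow> 'a) \<Rightarrow> ('v \<Rightarrow> real) \<Rightarrow> bool" where
  "ph_symmetric \<Gamma> \<theta> \<tau> \<sigma> VP VH p a r \<longleftrightarrow>
     (\<forall>\<gamma>\<in>carrier \<Gamma>.
        (\<forall>i\<in>VP. \<tau> \<gamma> (p i) = p (\<theta> \<gamma> i)) \<and>
        (\<forall>j\<in>VH. \<sigma> \<gamma> j \<in> {1, -1} \<and>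
           \<tau> \<gamma> (a j) = \<sigma> \<gamma> j *\<^sub>R a (\<theta> \<gamma> j) \<and>
           r j = \<sigma> \<gamma> j * r (\<theta> \<gamma> j)))"

definition ph_forced_rigid ::
  "('g, 'm) monoid_scheme \<Rightarrow> ('g \<Rightarrow> 'v \<Rightarrow> 'v) \<Rightarrow> ('g \<Rightarrow> 'a \<Rightarrow> 'a) \<Rightarrow> ('g \<Rightarrow> 'v \<Rightarrow> real) \<Rightarrow>
   'v set \<Rightarrow> 'v set \<Rightarrow> 'v set set \<Rightarrow> ('v \<Rightarrow> 'a::euclidean_space) \<Rightarrow> ('v \<Rightarrow> 'a) \<Rightarrow> bool" where
  "ph_forced_rigid \<Gamma> \<theta> \<tau> \<sigma> VP VH E p a \<longleftrightarrow>
     (\<forall>p' a' r'. ph_motion VP VH E p a p' a' r' \<and> ph_symmetric \<Gamma> \<theta> \<tau> \<sigma> VP VH p' a' r'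
        \<longrightarrow> ph_trivial_motion VP VH p a p' a' r')"

end

theory Submission
  imports Defs
begin

text \<open>
  A point \<open>p\<^sub>i\<close> is identified with the direction \<open>(p\<^sub>i, 1)\<close> and a hyperplane with normal \<open>a\<^sub>j\<close> with
  the direction \<open>(a\<^sub>j, 0)\<close>; velocities lift to \<open>(p'\<^sub>i, - p\<^sub>i \<bullet> p'\<^sub>i)\<close> and \<open>(a'\<^sub>j, r'\<^sub>j)\<close>. Under this lift the
  edge constraints, the trivial motions and the symmetry conditions of both kinds of frameworks
  agree, and rescaling each lifted vector together with its velocity by a nonzero weight changes
  none of them.

  From hyperplanes to the sphere, the weights normalise the points and absorb the signs \<open>\<sigma>\<close> on the
  hyperplanes: the signs form a cocycle, which is a coboundary because the action is free.

  From the sphere to hyperplanes, the only obstruction is a vertex outside \<open>X\<close> on the equator. Moving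
  all vertices outside \<open>X\<close> slightly in the direction \<open>(0, 1)\<close>, which is fixed by the augmented
  representation, preserves the symmetry, and it preserves forced rigidity by compactness: nontrivial
  motions of the perturbed frameworks, taken orthogonal to the symmetric trivial motions and of norm
  one, would accumulate at such a motion of the original framework.
\<close>

section \<open>Lifting point-hyperplane frameworks to cones\<close>

text \<open>The weights stay arbitrary because the two directions of the equivalence need different
  ones: last coordinates of given vectors in one, normalising factors and signs in the other. In the
  first case the vectors need not have norm one.\<close>

definition cone_point :: "'v set \<Rightarrow> ('v \<Rightarrow> real) \<Rightarrow> ('v \<Rightarrow> 'a::euclidean_space) \<Rightarrow> ('v \<Rightarrow> 'a) \<Rightarrow> 'v \<Rightarrow> 'a \<times> real"
  where "cone_point X w p a i = w i *\<^sub>R (if i \<in> X then (a i, 0) else (p i, 1))"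

text \<open>At a point, the last coordinate is the only one that orthogonality to
  \<open>(p i, 1)\<close> allows. At a hyperplane that orthogonality leaves the last coordinate
  free, and the offset velocity \<open>r' i\<close> fills it.\<close>

definition cone_velocity ::
  "'v set \<Rightarrow> ('v \<Rightarrow> real) \<Rightarrow> ('v \<Rightarrow> 'a::euclidean_space) \<Rightarrow> ('v \<Rightarrow> 'a) \<Rightarrow> ('v \<Rightarrow> 'a) \<Rightarrow> ('v \<Rightarrow> real) \<Rightarrow>
   'v \<Rightarrow> 'a \<times> real"
  where "cone_velocity X w p p' a' r' i =
    w i *\<^sub>R (if i \<in> X then (a' i, r' i) else (p' i, - (p i \<bullet> p' i)))"

section \<open>Constraints, symmetries and trivial motions under the lift\<close>

text \<open>Up to sign, each edge constraint of the lift is the point-hyperplane constraint times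
  the nonzero factor \<open>w i * w j\<close>. For two points, the products with the last
  coordinates supply the diagonal terms that complete
  \<open>- ((p i - p j) \<bullet> (p' i - p' j))\<close>.\<close>

lemma spherical_motion_cone_velocity_iff:
  assumes "X \<subseteq> V" and w: "\<And>i. i \<in> V \<Longrightarrow> w i \<noteq> 0"
  shows "spherical_motion V E (cone_point X w p a) (cone_velocity X w p p' a' r')
    \<longleftrightarrow> ph_motion (V - X) X E p a p' a' r'" (is "?L \<longleftrightarrow> ?R")
proof -
  let ?q = "cone_point X w p a" and ?q' = "cone_velocity X w p p' a' r'"
  let ?e = "\<lambda>i j. ?q i \<bullet> ?q' j + ?q j \<bullet> ?q' i = 0"
  have PP: "?e i j \<longleftrightarrow> (p i - p j) \<bullet> (p' i - p' j) = 0" if "i \<in> V - X" "j \<in> V - X" for i j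
  proof -
    have "?q i \<bullet> ?q' j + ?q j \<bullet> ?q' i = - (w i * w j) * ((p i - p j) \<bullet> (p' i - p' j))"
      using that by (simp add: cone_point_def cone_velocity_def inner_diff_left inner_diff_right algebra_simps)
    then show ?thesis using w that by simp
  qed
  have PH: "?e i j \<longleftrightarrow> p i \<bullet> a' j + p' i \<bullet> a j + r' j = 0" if "i \<in> V - X" "j \<in> X" for i j
  proof -
    have "?q i \<bullet> ?q' j + ?q j \<bullet> ?q' i = (w i * w j) * (p i \<bullet> a' j + p' i \<bullet> a j + r' j)"
      using that by (simp add: cone_point_def cone_velocity_def algebra_simps inner_commute)
    then show ?thesis using w that assms(1) by auto
  qed
  have HH: "?e i j \<longleftrightarrow> a i \<bullet> a' j + a' i \<bullet> a j = 0" if "i \<in> X" "j \<in> X" for i j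
  proof -
    have "?q i \<bullet> ?q' j + ?q j \<bullet> ?q' i = (w i * w j) * (a i \<bullet> a' j + a' i \<bullet> a j)"
      using that by (simp add: cone_point_def cone_velocity_def algebra_simps inner_commute)
    then show ?thesis using w that assms(1) by auto
  qed
  have P: "?q i \<bullet> ?q' i = 0" if "i \<in> V - X" for i
    using that by (simp add: cone_point_def cone_velocity_def algebra_simps)
  have H: "?q i \<bullet> ?q' i = 0 \<longleftrightarrow> a i \<bullet> a' i = 0" if "i \<in> X" for i
    using that w assms(1) by (auto simp add: cone_point_def cone_velocity_def)
  \<comment> \<open>The constraint is symmetric in its endpoints, so three of the four combinations
    of vertex kinds suffice.\<close>
  have "(\<forall>i\<in>V. \<forall>j\<in>V. {i, j} \<in> E \<longrightarrow> ?e i j) \<longleftrightarrow>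
      (\<forall>i\<in>V-X. \<forall>j\<in>V-X. {i, j} \<in> E \<longrightarrow> ?e i j) \<and>
      (\<forall>i\<in>V-X. \<forall>j\<in>X. {i, j} \<in> E \<longrightarrow> ?e i j) \<and>
      (\<forall>i\<in>X. \<forall>j\<in>X. {i, j} \<in> E \<longrightarrow> ?e i j)" (is "?l = ?r")
  proof
    assume ?l then show ?r using assms(1) by blast
  next
    assume r: ?r
    note rP = conjunct1[OF r, rule_format]
      and rPH = conjunct1[OF conjunct2[OF r], rule_format]
      and rH = conjunct2[OF conjunct2[OF r], rule_format]
    have "?e i j" if "i \<in> V" "j \<in> V" and e: "{i, j} \<in> E" for i j
    proof -
      from that consider "i \<in> V - X" "j \<in> V - X" | "i \<in> V - X" "j \<in> X"
        | "i \<in> X" "j \<in> V - X" | "i \<in> X" "j \<in> X" by blast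
      then show ?thesis
      proof cases
        case 1 then show ?thesis by (rule rP[OF _ _ e])
      next
        case 2 then show ?thesis by (rule rPH[OF _ _ e])
      next
        case 3
        have "{j, i} \<in> E" using e by (simp only: insert_commute)
        with 3 have "?e j i" by (intro rPH)
        then show ?thesis by (simp only: add.commute)
      next
        case 4 then show ?thesis by (rule rH[OF _ _ e])
      qed
    qed
    then show ?l by (intro ballI impI)
  qed
  moreover have "(\<forall>i\<in>V. ?q i \<bullet> ?q' i = 0) \<longleftrightarrow> (\<forall>i\<in>X. a i \<bullet> a' i = 0)"
    using P H assms(1) by blast
  ultimately show ?thesis
    unfolding spherical_motion_def ph_motion_def using PP PH HH by simp
qed

text \<open>No spherical motion is lost by the lift: at a point, orthogonality of
  \<open>q' i\<close> to the cone vector determines the last coordinate, and at a hyperplane both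
  components can be prescribed freely.\<close>

lemma spherical_motion_is_cone_velocity:
  assumes "X \<subseteq> V" and w: "\<And>i. i \<in> V \<Longrightarrow> w i \<noteq> 0"
    and m: "spherical_motion V E (cone_point X w p a) q'"
  shows "\<exists>p' a' r'. \<forall>i\<in>V. q' i = cone_velocity X w p p' a' r' i"
proof (intro exI ballI)
  fix i assume i: "i \<in> V"
  \<comment> \<open>One function serves as both \<open>p'\<close> and \<open>a'\<close>, since the
    lift reads the former only outside \<open>X\<close> and the latter only on
    \<open>X\<close>.\<close>
  let ?f = "\<lambda>i. (1 / w i) *\<^sub>R fst (q' i)"
  have "cone_point X w p a i \<bullet> q' i = 0" using m i by (simp add: spherical_motion_def)
  then have "i \<notin> X \<Longrightarrow> snd (q' i) = - (p i \<bullet> fst (q' i))"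
    using w[OF i] by (auto simp: cone_point_def inner_prod_def eq_neg_iff_add_eq_0 add.commute
        simp flip: distrib_left)
  then show "q' i = cone_velocity X w p ?f ?f (\<lambda>i. snd (q' i) / w i) i"
    using w[OF i] by (auto simp: cone_velocity_def prod_eq_iff)
qed

text \<open>At points, the last coordinate adds no condition: \<open>p i \<bullet> p' i\<close> is
  invariant once \<open>p\<close> and \<open>p'\<close> are equivariant, because
  \<open>\<tau> \<gamma>\<close> preserves inner products. At hyperplanes, the change of weight by
  \<open>\<sigma> \<gamma> j\<close> turns signed equivariance into plain equivariance.\<close>

lemma spherical_symmetric_cone_velocity_iff:
  assumes "X \<subseteq> V" and w: "\<And>i. i \<in> V \<Longrightarrow> w i \<noteq> 0"
    and \<tau>: "\<And>\<gamma>. \<gamma> \<in> carrier \<Gamma> \<Longrightarrow> orthogonal_transformation (\<tau> \<gamma>)"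
    and \<theta>X: "\<And>\<gamma> i. \<gamma> \<in> carrier \<Gamma> \<Longrightarrow> i \<in> V \<Longrightarrow> \<theta> \<gamma> i \<in> X \<longleftrightarrow> i \<in> X"
    and p: "\<And>\<gamma> i. \<gamma> \<in> carrier \<Gamma> \<Longrightarrow> i \<in> V - X \<Longrightarrow> \<tau> \<gamma> (p i) = p (\<theta> \<gamma> i)"
    and wP: "\<And>\<gamma> i. \<gamma> \<in> carrier \<Gamma> \<Longrightarrow> i \<in> V - X \<Longrightarrow> w (\<theta> \<gamma> i) = w i"
    and wH: "\<And>\<gamma> j. \<gamma> \<in> carrier \<Gamma> \<Longrightarrow> j \<in> X \<Longrightarrow> w (\<theta> \<gamma> j) = \<sigma> \<gamma> j * w j"
    and \<sigma>: "\<And>\<gamma> j. \<gamma> \<in> carrier \<Gamma> \<Longrightarrow> j \<in> X \<Longrightarrow> \<sigma> \<gamma> j \<in> {1, -1}"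
  shows "spherical_symmetric \<Gamma> \<theta> (augmented_rep \<tau>) V (cone_velocity X w p p' a' r')
    \<longleftrightarrow> ph_symmetric \<Gamma> \<theta> \<tau> \<sigma> (V - X) X p' a' r'"
proof -
  let ?q' = "cone_velocity X w p p' a' r'"
  let ?s = "\<lambda>\<gamma> i. augmented_rep \<tau> \<gamma> (?q' i) = ?q' (\<theta> \<gamma> i)"
  have lin: "linear (\<tau> \<gamma>)" and iso: "\<tau> \<gamma> x \<bullet> \<tau> \<gamma> y = x \<bullet> y" if "\<gamma> \<in> carrier \<Gamma>" for \<gamma> x y
    using \<tau>[OF that] by (auto simp: orthogonal_transformation_def)
  have P: "?s \<gamma> i \<longleftrightarrow> \<tau> \<gamma> (p' i) = p' (\<theta> \<gamma> i)" if g: "\<gamma> \<in> carrier \<Gamma>" and i: "i \<in> V - X" for \<gamma> i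
  proof -
    have "p i \<bullet> p' i = p (\<theta> \<gamma> i) \<bullet> \<tau> \<gamma> (p' i)"
      using iso[OF g, of "p i" "p' i"] p[OF g i] by simp
    then show ?thesis
      using i \<theta>X[OF g] wP[OF g i] w[of i]
      by (auto simp: cone_velocity_def augmented_rep_def linear_scale[OF lin[OF g]])
  qed
  have H: "?s \<gamma> j \<longleftrightarrow> \<tau> \<gamma> (a' j) = \<sigma> \<gamma> j *\<^sub>R a' (\<theta> \<gamma> j) \<and> r' j = \<sigma> \<gamma> j * r' (\<theta> \<gamma> j)"
    if g: "\<gamma> \<in> carrier \<Gamma>" and j: "j \<in> X" for \<gamma> j
  proof -
    have "\<theta> \<gamma> j \<in> X" "w j \<noteq> 0" using \<theta>X[OF g] j w assms(1) by auto
    then have "?s \<gamma> j \<longleftrightarrow> w j *\<^sub>R \<tau> \<gamma> (a' j) = w j *\<^sub>R (\<sigma> \<gamma> j *\<^sub>R a' (\<theta> \<gamma> j)) \<and>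
        w j * r' j = w j * (\<sigma> \<gamma> j * r' (\<theta> \<gamma> j))"
      using j by (simp add: cone_velocity_def augmented_rep_def linear_scale[OF lin[OF g]] wH[OF g j]
          mult_ac)
    then show ?thesis using \<open>w j \<noteq> 0\<close> by (simp only: scaleR_cancel_left mult_cancel_left) simp
  qed
  have "spherical_symmetric \<Gamma> \<theta> (augmented_rep \<tau>) V ?q' \<longleftrightarrow>
     (\<forall>\<gamma>\<in>carrier \<Gamma>. (\<forall>i\<in>V-X. ?s \<gamma> i) \<and> (\<forall>j\<in>X. ?s \<gamma> j))"
    unfolding spherical_symmetric_def using assms(1) by blast
  then show ?thesis unfolding ph_symmetric_def using P H \<sigma> by simp
qed

text \<open>This is the block form of a skew-symmetric matrix of order d + 1. The block
  \<open>A\<close> is an infinitesimal rotation and the column \<open>u\<close> an infinitesimal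
  translation, so the pair is exactly the data of an infinitesimal isometry of the space of
  dimension d.\<close>

lemma skew_symmetric_prod_iff:
  fixes S :: "'a::euclidean_space \<times> real \<Rightarrow> 'a \<times> real"
  shows "skew_symmetric S \<longleftrightarrow>
    (\<exists>A u. skew_symmetric A \<and> S = (\<lambda>(x, s). (A x + s *\<^sub>R u, - (x \<bullet> u))))"
proof
  assume S: "skew_symmetric S"
  then have lin: "linear S" and sk: "S x \<bullet> y = - (x \<bullet> S y)" for x y
    unfolding skew_symmetric_def by blast+
  define A where "A = (\<lambda>x. fst (S (x, 0)))"
  define u where "u = fst (S (0, 1))"
  have "linear A"
    unfolding A_def by (intro linearI) (simp_all flip: linear_add[OF lin] linear_scale[OF lin] fst_add fst_scaleR)
  moreover have "A x \<bullet> y = - (x \<bullet> A y)" for x y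
    using sk[of "(x, 0)" "(y, 0)"] by (simp add: A_def inner_prod_def)
  ultimately have "skew_symmetric A" by (simp add: skew_symmetric_def)
  moreover have "S (x, s) = (A x + s *\<^sub>R u, - (x \<bullet> u))" for x s
  proof -
    have "S (x, s) = S (x, 0) + s *\<^sub>R S (0, 1)"
      by (simp flip: linear_add[OF lin] linear_scale[OF lin])
    moreover have "snd (S (x, 0)) = - (x \<bullet> u)"
      using sk[of "(x, 0)" "(0, 1)"] by (simp add: u_def inner_prod_def)
    moreover have "snd (S (0, 1)) = 0"
      using sk[of "(0, 1)" "(0, 1)"] by (simp add: inner_prod_def)
    ultimately show ?thesis by (simp add: prod_eq_iff A_def u_def)
  qed
  then have "S = (\<lambda>(x, s). (A x + s *\<^sub>R u, - (x \<bullet> u)))" by auto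
  ultimately show "\<exists>A u. skew_symmetric A \<and> S = (\<lambda>(x, s). (A x + s *\<^sub>R u, - (x \<bullet> u)))" by blast
next
  assume "\<exists>A u. skew_symmetric A \<and> S = (\<lambda>(x, s). (A x + s *\<^sub>R u, - (x \<bullet> u)))"
  then obtain A u where A: "skew_symmetric A" and S: "S = (\<lambda>(x, s). (A x + s *\<^sub>R u, - (x \<bullet> u)))"
    by blast
  then have lin: "linear A" and sk: "A x \<bullet> y = - (x \<bullet> A y)" for x y
    by (auto simp: skew_symmetric_def)
  have "linear S"
    unfolding S by (intro linearI)
      (auto simp: linear_add[OF lin] linear_scale[OF lin] algebra_simps inner_add_left)
  then show "skew_symmetric S"
    unfolding skew_symmetric_def S
    by (auto simp: sk inner_add_left inner_add_right inner_commute[of u])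
qed

text \<open>The block form sends \<open>(p i, 1)\<close> to
  \<open>(A (p i) + u, - (p i \<bullet> u))\<close> and \<open>(a j, 0)\<close> to
  \<open>(A (a j), - (a j \<bullet> u))\<close>. The last coordinate at a point matches that of the
  lift because \<open>x \<bullet> A x = 0\<close> for skew-symmetric \<open>A\<close>.\<close>

lemma spherical_trivial_motion_cone_velocity_iff:
  fixes p a :: "'v \<Rightarrow> 'a::euclidean_space"
  assumes "X \<subseteq> V" and w: "\<And>i. i \<in> V \<Longrightarrow> w i \<noteq> 0"
  shows "spherical_trivial_motion V (cone_point X w p a) (cone_velocity X w p p' a' r')
    \<longleftrightarrow> ph_trivial_motion (V - X) X p a p' a' r'"
proof -
  let ?q = "cone_point X w p a" and ?q' = "cone_velocity X w p p' a' r'"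
  define T where "T A u = (\<lambda>(x, s). (A x + s *\<^sub>R u, - (x \<bullet> u)))"
    for A :: "'a \<Rightarrow> 'a" and u
  have key: "(\<forall>i\<in>V. ?q' i = T A u (?q i)) \<longleftrightarrow> (\<forall>i\<in>V - X. p' i = A (p i) + u) \<and>
      (\<forall>j\<in>X. a' j = A (a j) \<and> r' j = - (a j \<bullet> u))" if A: "skew_symmetric A" for A u
  proof -
    have lin: "linear A" and sk: "A x \<bullet> y = - (x \<bullet> A y)" for x y
      using A by (auto simp: skew_symmetric_def)
    have "A x \<bullet> x = 0" for x using sk[of x x] by (simp add: inner_commute)
    then have z: "x \<bullet> A x = 0" for x by (simp add: inner_commute)
    have P: "?q' i = T A u (?q i) \<longleftrightarrow> p' i = A (p i) + u" if i: "i \<in> V - X" for i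
    proof -
      have "?q' i = T A u (?q i) \<longleftrightarrow> w i *\<^sub>R p' i = w i *\<^sub>R (A (p i) + u) \<and>
          w i * (p i \<bullet> p' i) = w i * (p i \<bullet> u)"
        using i by (simp add: cone_point_def cone_velocity_def T_def linear_scale[OF lin] scaleR_add_right)
      then show ?thesis using w[of i] i by (auto simp: inner_add_right z)
    qed
    have H: "?q' i = T A u (?q i) \<longleftrightarrow> a' i = A (a i) \<and> r' i = - (a i \<bullet> u)" if i: "i \<in> X" for i
    proof -
      have "?q' i = T A u (?q i) \<longleftrightarrow> w i *\<^sub>R a' i = w i *\<^sub>R A (a i) \<and>
          w i * r' i = w i * (- (a i \<bullet> u))"
        using i by (simp add: cone_point_def cone_velocity_def T_def linear_scale[OF lin])
      moreover have "w i \<noteq> 0" using w i assms(1) by auto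
      ultimately show ?thesis by (simp only: scaleR_cancel_left mult_cancel_left) simp
    qed
    show ?thesis using P H assms(1) by blast
  qed
  have T: "skew_symmetric S \<longleftrightarrow> (\<exists>A u. skew_symmetric A \<and> S = T A u)" for S
    unfolding T_def by (rule skew_symmetric_prod_iff)
  have "spherical_trivial_motion V ?q ?q' \<longleftrightarrow>
      (\<exists>A u. skew_symmetric A \<and> (\<forall>i\<in>V. ?q' i = T A u (?q i)))"
    unfolding spherical_trivial_motion_def T by blast
  also have "\<dots> \<longleftrightarrow> ph_trivial_motion (V - X) X p a p' a' r'"
    unfolding ph_trivial_motion_def by (simp only: key cong: conj_cong)
  finally show ?thesis .
qed

text \<open>The three equivalences above transport rigidity from the cone at once, since every
  velocity of the point-hyperplane framework has a lift. The converse also needs every spherical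
  motion to agree on \<open>V\<close> with a lift.\<close>

lemma forced_rigid_cone_iff:
  fixes p a :: "'v \<Rightarrow> 'a::euclidean_space"
  assumes "X \<subseteq> V" and w: "\<And>i. i \<in> V \<Longrightarrow> w i \<noteq> 0"
    and \<tau>: "\<And>\<gamma>. \<gamma> \<in> carrier \<Gamma> \<Longrightarrow> orthogonal_transformation (\<tau> \<gamma>)"
    and \<theta>V: "\<And>\<gamma> i. \<gamma> \<in> carrier \<Gamma> \<Longrightarrow> i \<in> V \<Longrightarrow> \<theta> \<gamma> i \<in> V"
    and \<theta>X: "\<And>\<gamma> i. \<gamma> \<in> carrier \<Gamma> \<Longrightarrow> i \<in> V \<Longrightarrow> \<theta> \<gamma> i \<in> X \<longleftrightarrow> i \<in> X"
    and p: "\<And>\<gamma> i. \<gamma> \<in> carrier \<Gamma> \<Longrightarrow> i \<in> V - X \<Longrightarrow> \<tau> \<gamma> (p i) = p (\<theta> \<gamma> i)"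
    and wP: "\<And>\<gamma> i. \<gamma> \<in> carrier \<Gamma> \<Longrightarrow> i \<in> V - X \<Longrightarrow> w (\<theta> \<gamma> i) = w i"
    and wH: "\<And>\<gamma> j. \<gamma> \<in> carrier \<Gamma> \<Longrightarrow> j \<in> X \<Longrightarrow> w (\<theta> \<gamma> j) = \<sigma> \<gamma> j * w j"
    and \<sigma>: "\<And>\<gamma> j. \<gamma> \<in> carrier \<Gamma> \<Longrightarrow> j \<in> X \<Longrightarrow> \<sigma> \<gamma> j \<in> {1, -1}"
  shows "spherical_forced_rigid \<Gamma> \<theta> (augmented_rep \<tau>) V E (cone_point X w p a)
    \<longleftrightarrow> ph_forced_rigid \<Gamma> \<theta> \<tau> \<sigma> (V - X) X E p a"
proof -
  have motion: "spherical_motion V E (cone_point X w p a) (cone_velocity X w p p' a' r')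
      \<longleftrightarrow> ph_motion (V - X) X E p a p' a' r'" for p' a' r'
    using assms(1) w by (rule spherical_motion_cone_velocity_iff)
  have sym: "spherical_symmetric \<Gamma> \<theta> (augmented_rep \<tau>) V (cone_velocity X w p p' a' r')
      \<longleftrightarrow> ph_symmetric \<Gamma> \<theta> \<tau> \<sigma> (V - X) X p' a' r'" for p' a' r'
    using assms(1) w \<tau> \<theta>X p wP wH \<sigma> by (rule spherical_symmetric_cone_velocity_iff)
  have triv: "spherical_trivial_motion V (cone_point X w p a) (cone_velocity X w p p' a' r')
      \<longleftrightarrow> ph_trivial_motion (V - X) X p a p' a' r'" for p' a' r'
    using assms(1) w by (rule spherical_trivial_motion_cone_velocity_iff)
  let ?q = "cone_point X w p a"
  show ?thesis
  proof
    assume "spherical_forced_rigid \<Gamma> \<theta> (augmented_rep \<tau>) V E ?q"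
    then show "ph_forced_rigid \<Gamma> \<theta> \<tau> \<sigma> (V - X) X E p a"
      unfolding spherical_forced_rigid_def ph_forced_rigid_def
      by (auto simp flip: motion sym triv)
  next
    assume R: "ph_forced_rigid \<Gamma> \<theta> \<tau> \<sigma> (V - X) X E p a"
    show "spherical_forced_rigid \<Gamma> \<theta> (augmented_rep \<tau>) V E ?q"
      unfolding spherical_forced_rigid_def
    proof (intro allI impI, elim conjE)
      fix q' assume m: "spherical_motion V E ?q q'"
        and s: "spherical_symmetric \<Gamma> \<theta> (augmented_rep \<tau>) V q'"
      obtain p' a' r' where eq: "\<And>i. i \<in> V \<Longrightarrow> q' i = cone_velocity X w p p' a' r' i"
        using spherical_motion_is_cone_velocity[OF assms(1) _ m] w by auto
      have "ph_motion (V - X) X E p a p' a' r'"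
        using m by (simp add: eq spherical_motion_def flip: motion)
      moreover have "ph_symmetric \<Gamma> \<theta> \<tau> \<sigma> (V - X) X p' a' r'"
        using s by (simp add: eq \<theta>V spherical_symmetric_def flip: sym)
      ultimately have "ph_trivial_motion (V - X) X p a p' a' r'"
        using R unfolding ph_forced_rigid_def by blast
      then show "spherical_trivial_motion V ?q q'"
        by (simp add: eq spherical_trivial_motion_def flip: triv)
    qed
  qed
qed

section \<open>Spanning conditions in homogeneous coordinates\<close>

text \<open>The slice of the linear span at height 1 is an affine set containing \<open>S\<close>;
  if it is everything, differences of its elements give height 0 and hence all vectors. Conversely,
  a full span makes the differences from a base point span the whole direction space.\<close>

lemma affine_hull_eq_UNIV_iff:
  fixes S :: "'a::euclidean_space set"
  shows "affine hull S = UNIV \<longleftrightarrow> span ((\<lambda>x. (x, 1::real)) ` S) = UNIV" (is "_ \<longleftrightarrow> span ?S1 = UNIV")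
proof
  assume "affine hull S = UNIV"
  moreover have "affine {x. (x, 1) \<in> span ?S1}"
    unfolding affine_def
  proof clarify
    fix x y u v assume "(x, 1) \<in> span ?S1" "(y, 1) \<in> span ?S1" and uv: "u + v = (1::real)"
    then have "u *\<^sub>R (x, 1) + v *\<^sub>R (y, 1) \<in> span ?S1"
      by (intro span_add span_scale)
    with uv show "(u *\<^sub>R x + v *\<^sub>R y, 1) \<in> span ?S1" by simp
  qed
  then have "affine hull S \<subseteq> {x. (x, 1) \<in> span ?S1}"
    by (intro hull_minimal) (auto intro: span_base)
  ultimately have 1: "(x, 1) \<in> span ?S1" for x by auto
  have "(x, s) \<in> span ?S1" for x s
    using span_add[OF span_diff[OF 1[of x] 1[of 0]] span_scale[OF 1[of 0], of s]] by simp
  then show "span ?S1 = UNIV" by auto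
next
  assume sp: "span ?S1 = UNIV"
  have "S \<noteq> {}"
  proof
    assume "S = {}"
    with sp have "(0::'a, 1::real) \<in> {0}" by simp
    then show False by (simp add: zero_prod_def)
  qed
  then obtain s where s: "s \<in> S" by blast
  let ?D = "span ((\<lambda>x. x - s) ` S)"
  \<comment> \<open>This is the preimage of \<open>?D\<close> under the linear map taking
    \<open>(x, t)\<close> to \<open>x - t *\<^sub>R s\<close>. It contains all lifted points of
    \<open>S\<close>, and at height 1 membership reads \<open>x - s \<in> ?D\<close>.\<close>
  have "subspace {z. fst z - snd z *\<^sub>R s \<in> ?D}"
  proof (rule subspaceI)
    fix z y :: "'a \<times> real" assume "z \<in> {z. fst z - snd z *\<^sub>R s \<in> ?D}" "y \<in> {z. fst z - snd z *\<^sub>R s \<in> ?D}"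
    then have "(fst z - snd z *\<^sub>R s) + (fst y - snd y *\<^sub>R s) \<in> ?D" by (auto intro: span_add)
    then show "z + y \<in> {z. fst z - snd z *\<^sub>R s \<in> ?D}" by (simp add: algebra_simps)
  next
    fix c :: real and z :: "'a \<times> real" assume "z \<in> {z. fst z - snd z *\<^sub>R s \<in> ?D}"
    then have "c *\<^sub>R (fst z - snd z *\<^sub>R s) \<in> ?D" by (auto intro: span_scale)
    then show "c *\<^sub>R z \<in> {z. fst z - snd z *\<^sub>R s \<in> ?D}" by (simp add: algebra_simps)
  qed (simp add: span_zero)
  then have "span ?S1 \<subseteq> {z. fst z - snd z *\<^sub>R s \<in> ?D}"
    by (intro span_minimal) (auto intro: span_base)
  then have D: "x - s \<in> ?D" for x using sp by (auto dest!: subsetD[where c = "(x, 1)"])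
  have "affine hull S = {s + v | v. v \<in> span {x - s |x. x \<in> S}}"
  proof -
    \<comment> \<open>\<open>affine_hull_insert_span\<close> is applied with the base point split
      off from \<open>S\<close>; the difference lost in this way is 0, which does not affect the
      span.\<close>
    have "insert s (S - {s}) = S" using s by blast
    moreover have "{x - s |x. x \<in> S} = insert 0 {x - s |x. x \<in> S - {s}}" using s by auto
    then have "span {x - s |x. x \<in> S} = span {x - s |x. x \<in> S - {s}}"
      by (simp only: span_insert_0)
    ultimately show ?thesis
      using affine_hull_insert_span[of s "S - {s}"] by simp
  qed
  also have "{x - s |x. x \<in> S} = (\<lambda>x. x - s) ` S" by auto
  also have "{s + v | v. v \<in> ?D} = UNIV"
  proof -
    have "x = s + (x - s)" for x by simp
    then show ?thesis using D by blast
  qed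
  finally show "affine hull S = UNIV" .
qed

text \<open>In homogeneous coordinates the generators of the affine hull are \<open>(p i, 1)\<close>
  and \<open>(p i + a j, 1)\<close>. Given one point, they span the same space as the vectors
  \<open>(p i, 1)\<close> and \<open>(a j, 0)\<close>, to which the nonzero weights make no
  difference.\<close>

lemma span_cone_eq_UNIV_iff:
  fixes p a :: "'v \<Rightarrow> 'a::euclidean_space"
  assumes "X \<subseteq> V" and w: "\<And>i. i \<in> V \<Longrightarrow> w i \<noteq> 0"
  shows "span (cone_point X w p a ` V) = UNIV \<longleftrightarrow>
    affine hull (p ` (V - X) \<union> {p i + a j |i j. i \<in> V - X \<and> j \<in> X}) = UNIV"
    (is "span ?C = UNIV \<longleftrightarrow> affine hull ?S = UNIV")
proof -
  let ?S1 = "(\<lambda>x. (x, 1::real)) ` ?S"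
  have P: "(p i, 1) \<in> span ?C" if "i \<in> V - X" for i
  proof -
    have "cone_point X w p a i \<in> span ?C" using that by (auto intro: span_base)
    from span_scale[OF this, of "1 / w i"] show ?thesis using that w[of i] by (simp add: cone_point_def)
  qed
  have H: "(a i, 0) \<in> span ?C" if "i \<in> X" for i
  proof -
    have "cone_point X w p a i \<in> span ?C" using that assms(1) by (auto intro: span_base)
    from span_scale[OF this, of "1 / w i"] show ?thesis
      using that assms(1) w[of i] by (auto simp add: cone_point_def)
  qed
  have "?S1 \<subseteq> span ?C"
    using P span_add[OF P H] by auto
  then have 1: "span ?S1 \<subseteq> span ?C" by (simp add: span_minimal)
  show ?thesis
  proof
    assume U: "span ?C = UNIV"
    \<comment> \<open>Without a point all cone vectors would have last coordinate 0. The point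
      \<open>k\<close> found here exhibits each \<open>(a j, 0)\<close> as a difference of two
      generators.\<close>
    have "V - X \<noteq> {}"
    proof
      assume "V - X = {}"
      then have "?C \<subseteq> UNIV \<times> {0}" by (auto simp: cone_point_def)
      moreover have "subspace (UNIV \<times> {0} :: ('a \<times> real) set)"
        by (intro subspace_Times) auto
      ultimately have "span ?C \<subseteq> UNIV \<times> {0}" by (rule span_minimal)
      with U have "(0::'a, 1::real) \<in> UNIV \<times> {0}" by blast
      then show False by simp
    qed
    then obtain k where k: "k \<in> V - X" by blast
    have b: "(p i, 1) \<in> span ?S1" if "i \<in> V - X" for i using that by (auto intro!: span_base)
    have "(a j, 0) \<in> span ?S1" if "j \<in> X" for j
    proof -
      have "(p k + a j, 1) \<in> span ?S1" using that k by (auto intro!: span_base)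
      from span_diff[OF this b[OF k]] show ?thesis by simp
    qed
    then have "cone_point X w p a i \<in> span ?S1" if "i \<in> V" for i
      using b that unfolding cone_point_def by (intro span_scale) auto
    then have "span ?C \<subseteq> span ?S1" by (intro span_minimal) auto
    with U show "affine hull ?S = UNIV" unfolding affine_hull_eq_UNIV_iff by auto
  next
    assume "affine hull ?S = UNIV"
    with 1 show "span ?C = UNIV" unfolding affine_hull_eq_UNIV_iff by auto
  qed
qed

section \<open>Stability of forced rigidity\<close>

text \<open>The rank-one maps between basis vectors span. Through this lemma a subspace of linear
  maps gets a finite generating set, on which the projection below can be built by
  induction.\<close>

lemma finite_span_blinfun:
  obtains F :: "('a::euclidean_space \<Rightarrow>\<^sub>L 'b::euclidean_space) set" where "finite F" "span F = UNIV"
proof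
  define e :: "'b \<Rightarrow> 'a \<Rightarrow> 'a \<Rightarrow>\<^sub>L 'b" where "e k l = Blinfun (\<lambda>v. (v \<bullet> l) *\<^sub>R k)" for k l
  let ?F = "(\<lambda>(k, l). e k l) ` (Basis \<times> Basis)"
  have e: "blinfun_apply (e k l) v = (v \<bullet> l) *\<^sub>R k" for k l v
    unfolding e_def by (subst bounded_linear_Blinfun_apply) (auto intro!: bounded_linear_intros)
  show "finite ?F" by simp
  have "L \<in> span ?F" for L :: "'a \<Rightarrow>\<^sub>L 'b"
  proof -
    have "L = (\<Sum>k\<in>Basis. \<Sum>l\<in>Basis. (L l \<bullet> k) *\<^sub>R e k l)"
    proof (rule blinfun_eqI)
      fix v
      have "L v = blinfun_of_matrix (\<lambda>i j. L j \<bullet> i) v" by (simp add: blinfun_of_matrix_works)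
      then show "L v = (\<Sum>k\<in>Basis. \<Sum>l\<in>Basis. (L l \<bullet> k) *\<^sub>R e k l) v"
        by (simp add: blinfun_of_matrix_apply blinfun.sum_left blinfun.scaleR_left e mult.commute)
    qed
    also have "\<dots> \<in> span ?F" by (intro span_sum span_scale span_base) auto
    finally show ?thesis .
  qed
  then show "span ?F = UNIV" by auto
qed

text \<open>Gram-Schmidt on the generators, for the family \<open>f\<close> and the subspace of
  families \<open>T i h\<close> with \<open>h\<close> in \<open>span F\<close>. The projection is
  expressed by its parameter \<open>k\<close>, and \<open>T\<close> may have a kernel.\<close>

lemma exists_orthogonal_projection:
  fixes T :: "'v \<Rightarrow> 'k::real_vector \<Rightarrow> 'b::real_inner"
  assumes "finite V" and lin: "\<And>i. i \<in> V \<Longrightarrow> linear (T i)" and "finite F"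
  shows "\<exists>k\<in>span F. \<forall>h\<in>span F. (\<Sum>i\<in>V. (f i - T i k) \<bullet> T i h) = 0"
  using \<open>finite F\<close>
proof (induction F arbitrary: f)
  case empty
  show ?case by (simp add: linear_0[OF lin])
next
  case (insert z F)
  obtain k where k: "k \<in> span F" "\<And>h. h \<in> span F \<Longrightarrow> (\<Sum>i\<in>V. (f i - T i k) \<bullet> T i h) = 0"
    using insert.IH[of f] by blast
  \<comment> \<open>As \<open>f\<close> is arbitrary in the induction, the new generator can itself
    be projected; \<open>y\<close> is its part orthogonal to the old span.\<close>
  obtain u where u: "u \<in> span F" "\<And>h. h \<in> span F \<Longrightarrow> (\<Sum>i\<in>V. (T i z - T i u) \<bullet> T i h) = 0"
    using insert.IH[of "\<lambda>i. T i z"] by blast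
  define y where "y = z - u"
  have y: "(\<Sum>i\<in>V. T i y \<bullet> T i h) = 0" if "h \<in> span F" for h
    using u(2)[OF that] by (simp add: y_def linear_diff[OF lin])
  define c where "c = (\<Sum>i\<in>V. f i \<bullet> T i y) / (\<Sum>i\<in>V. T i y \<bullet> T i y)"
  \<comment> \<open>If the denominator of \<open>c\<close> is 0, then every \<open>T i y\<close>
    vanishes and both sides are 0.\<close>
  have fc: "(\<Sum>i\<in>V. f i \<bullet> T i y) = c * (\<Sum>i\<in>V. T i y \<bullet> T i y)"
  proof (cases "(\<Sum>i\<in>V. T i y \<bullet> T i y) = 0")
    case True
    then have "\<forall>i\<in>V. T i y \<bullet> T i y = 0" by (simp add: sum_nonneg_eq_0_iff \<open>finite V\<close>)
    then show ?thesis by simp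
  qed (simp add: c_def)
  have "y \<in> span (insert z F)"
    unfolding y_def using u(1) by (meson insertI1 span_base span_diff span_mono subset_insertI subsetD)
  moreover have "k \<in> span (insert z F)" using k(1) span_mono[of F "insert z F"] by blast
  ultimately have "k + c *\<^sub>R y \<in> span (insert z F)" by (intro span_add span_scale)
  moreover have "(\<Sum>i\<in>V. (f i - T i (k + c *\<^sub>R y)) \<bullet> T i h) = 0" if hF: "h \<in> span (insert z F)" for h
  proof -
    \<comment> \<open>The vector \<open>h\<close> is split along \<open>span F\<close> and
      \<open>y\<close> instead of \<open>span F\<close> and \<open>z\<close>, so that the mixed
      terms vanish.\<close>
    obtain s where "h - s *\<^sub>R z \<in> span F" using hF by (auto simp: span_breakdown_eq)
    then have h': "(h - s *\<^sub>R z) + s *\<^sub>R u \<in> span F" using u(1) by (intro span_add span_scale)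
    define h' where "h' = (h - s *\<^sub>R z) + s *\<^sub>R u"
    have h: "h = h' + s *\<^sub>R y" by (simp add: h'_def y_def algebra_simps)
    have "(\<Sum>i\<in>V. (f i - T i (k + c *\<^sub>R y)) \<bullet> T i h) =
      (\<Sum>i\<in>V. (f i - T i k) \<bullet> T i h' - c * (T i y \<bullet> T i h') + s * (f i \<bullet> T i y)
         - s * (T i y \<bullet> T i k) - s * c * (T i y \<bullet> T i y))"
      by (rule sum.cong) (simp_all add: h linear_add[OF lin] linear_scale[OF lin] inner_diff_left
          inner_add_left inner_add_right inner_commute algebra_simps)
    also have "\<dots> = (\<Sum>i\<in>V. (f i - T i k) \<bullet> T i h') - c * (\<Sum>i\<in>V. T i y \<bullet> T i h')
         + s * (\<Sum>i\<in>V. f i \<bullet> T i y) - s * (\<Sum>i\<in>V. T i y \<bullet> T i k) - s * c * (\<Sum>i\<in>V. T i y \<bullet> T i y)"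
      by (simp add: sum.distrib sum_subtractf sum_distrib_left)
    also have "\<dots> = 0"
      using k(2) y k(1) h' fc by (simp add: h'_def)
    finally show ?thesis .
  qed
  ultimately show ?case by blast
qed

lemma not_eventually_subseq:
  assumes "\<not> (\<forall>\<^sub>F n in sequentially. P n)"
  shows "\<exists>r :: nat \<Rightarrow> nat. strict_mono r \<and> (\<forall>n. \<not> P (r n))"
proof -
  have "infinite {n. \<not> P n}"
    using assms by (simp add: cofinite_eq_sequentially[symmetric] eventually_cofinite)
  from infinite_enumerate[OF this] show ?thesis by simp
qed

text \<open>Bolzano-Weierstrass at one vertex after another, each time passing to a further
  subsequence.\<close>

lemma bounded_family_convergent_subseq:
  fixes f :: "nat \<Rightarrow> 'v \<Rightarrow> 'b::heine_borel"
  assumes "finite V" and "\<And>i. i \<in> V \<Longrightarrow> bounded (range (\<lambda>n. f n i))"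
  shows "\<exists>l r. strict_mono (r :: nat \<Rightarrow> nat) \<and> (\<forall>i\<in>V. (\<lambda>n. f (r n) i) \<longlonglongrightarrow> l i)"
  using assms
proof (induction V)
  case empty
  show ?case using strict_mono_id by blast
next
  case (insert j V)
  then obtain l r where r: "strict_mono (r :: nat \<Rightarrow> nat)" "\<And>i. i \<in> V \<Longrightarrow> (\<lambda>n. f (r n) i) \<longlonglongrightarrow> l i"
    by auto
  have "bounded (range (\<lambda>n. f (r n) j))"
    using insert.prems[of j] by (rule bounded_subset) auto
  from bounded_imp_convergent_subsequence[OF this]
  obtain m s where s: "strict_mono (s :: nat \<Rightarrow> nat)" "((\<lambda>n. f (r n) j) \<circ> s) \<longlonglongrightarrow> m" by blast
  have "(\<lambda>n. f ((r \<circ> s) n) i) \<longlonglongrightarrow> (l(j := m)) i" if "i \<in> insert j V" for i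
    using that s(2) LIMSEQ_subseq_LIMSEQ[OF r(2)[of i] s(1)] insert.hyps by (auto simp: o_def)
  then show ?case using strict_mono_o[OF r(1) s(1)] by blast
qed

text \<open>Spanning is an open condition: unit normals to deficient spans would accumulate at a
  unit vector orthogonal to every \<open>q i\<close>.\<close>

lemma eventually_span_eq_UNIV:
  fixes q :: "'v \<Rightarrow> 'b::euclidean_space"
  assumes lim: "\<And>i. i \<in> V \<Longrightarrow> (\<lambda>n. Q n i) \<longlonglongrightarrow> q i" and span: "span (q ` V) = UNIV"
  shows "\<forall>\<^sub>F n in sequentially. span (Q n ` V) = UNIV"
proof (rule ccontr)
  assume "\<not> ?thesis"
  from not_eventually_subseq[OF this] obtain r where r: "strict_mono (r :: nat \<Rightarrow> nat)" "\<forall>n. span (Q (r n) ` V) \<noteq> UNIV" by blast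
  have "\<exists>u. norm u = 1 \<and> (\<forall>i\<in>V. u \<bullet> Q (r n) i = 0)" for n
  proof -
    obtain u where u: "u \<noteq> 0" "\<forall>x\<in>span (Q (r n) ` V). u \<bullet> x = 0"
      using span_not_UNIV_orthogonal[OF r(2)[rule_format, of n]] by blast
    then have "norm (u /\<^sub>R norm u) = 1" "\<forall>i\<in>V. (u /\<^sub>R norm u) \<bullet> Q (r n) i = 0"
      by (auto intro: span_base)
    then show ?thesis by blast
  qed
  then obtain u where u: "\<And>n. norm (u n) = 1" "\<And>n i. i \<in> V \<Longrightarrow> u n \<bullet> Q (r n) i = 0" by metis
  have "\<forall>n. u n \<in> sphere 0 1" using u by simp
  then obtain v s where v: "v \<in> sphere 0 1" and s: "strict_mono (s :: nat \<Rightarrow> nat)" "(u \<circ> s) \<longlonglongrightarrow> v"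
    using compact_sphere[of "0::'b" 1] unfolding compact_def by blast
  have "v \<bullet> q i = 0" if i: "i \<in> V" for i
  proof -
    have "(\<lambda>n. Q ((r \<circ> s) n) i) \<longlonglongrightarrow> q i"
      using LIMSEQ_subseq_LIMSEQ[OF lim[OF i] strict_mono_o[OF r(1) s(1)]] by (simp add: o_def)
    from tendsto_inner[OF s(2) this] have "(\<lambda>n. 0) \<longlonglongrightarrow> v \<bullet> q i" using u(2)[OF i] by simp
    then show ?thesis by (simp add: LIMSEQ_const_iff)
  qed
  then have "orthogonal v x" if "x \<in> span (q ` V)" for x
    by (intro orthogonal_to_span[OF that]) (auto simp: orthogonal_def)
  then have "v \<bullet> v = 0" using span by (simp add: orthogonal_def)
  then show False using v by simp
qed

section \<open>Forced rigidity under small symmetric perturbations\<close>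

lemma spherical_motion_scaled_diff:
  assumes "spherical_motion V E q f" "spherical_motion V E q g"
  shows "spherical_motion V E q (\<lambda>i. c *\<^sub>R (f i - g i))"
proof -
  have "q i \<bullet> (c *\<^sub>R (f j - g j)) + q j \<bullet> (c *\<^sub>R (f i - g i)) =
      c * (q i \<bullet> f j + q j \<bullet> f i) - c * (q i \<bullet> g j + q j \<bullet> g i)" for i j
    by (simp add: inner_diff_right algebra_simps)
  then show ?thesis using assms by (simp add: spherical_motion_def inner_diff_right)
qed

lemma spherical_motion_skew_symmetric:
  assumes "skew_symmetric S"
  shows "spherical_motion V E q (\<lambda>i. S (q i))"
proof -
  have sk: "x \<bullet> S y + y \<bullet> S x = 0" for x y
    using assms by (simp add: skew_symmetric_def inner_commute[of y])
  moreover have "x \<bullet> S x = 0" for x using sk[of x x] by simp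
  ultimately show ?thesis by (simp add: spherical_motion_def)
qed

text \<open>Motion constraints, symmetry, norm one and orthogonality to symmetric trivial motions
  all pass to a limit \<open>h\<close>. Rigidity of \<open>q\<close> makes \<open>h\<close> trivial,
  and since \<open>q\<close> spans, the skew map inducing it is equivariant. Then \<open>h\<close>
  is orthogonal to itself, against its norm.\<close>

lemma eventually_spherical_forced_rigid:
  fixes q :: "'v \<Rightarrow> 'b::euclidean_space"
  assumes "finite V" and lin: "\<And>\<gamma>. \<gamma> \<in> carrier \<Gamma> \<Longrightarrow> linear (\<rho> \<gamma>)"
    and \<theta>V: "\<And>\<gamma> i. \<gamma> \<in> carrier \<Gamma> \<Longrightarrow> i \<in> V \<Longrightarrow> \<theta> \<gamma> i \<in> V"
    and lim: "\<And>i. i \<in> V \<Longrightarrow> (\<lambda>n. Q n i) \<longlonglongrightarrow> q i" and span: "span (q ` V) = UNIV"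
    and symQ: "\<And>n. spherical_symmetric \<Gamma> \<theta> \<rho> V (Q n)"
    and symq: "spherical_symmetric \<Gamma> \<theta> \<rho> V q"
    and rigid: "spherical_forced_rigid \<Gamma> \<theta> \<rho> V E q"
  shows "\<forall>\<^sub>F n in sequentially. spherical_forced_rigid \<Gamma> \<theta> \<rho> V E (Q n)"
proof (rule ccontr)
  assume "\<not> ?thesis"
  from not_eventually_subseq[OF this] obtain r where r: "strict_mono (r :: nat \<Rightarrow> nat)" "\<forall>n. \<not> spherical_forced_rigid \<Gamma> \<theta> \<rho> V E (Q (r n))" by blast
  \<comment> \<open>These are the skew maps whose trivial motions are symmetric for every symmetric
    framework. Subtracting such a motion keeps a motion symmetric, and \<open>K\<close> does not
    depend on \<open>n\<close>, so one fixed element can be tested along the whole sequence.\<close>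
  define K where "K = {L :: 'b \<Rightarrow>\<^sub>L 'b. skew_symmetric (blinfun_apply L) \<and>
    (\<forall>\<gamma>\<in>carrier \<Gamma>. \<forall>x. \<rho> \<gamma> (L x) = L (\<rho> \<gamma> x))}"
  have skew_blinfun: "skew_symmetric (blinfun_apply L) \<longleftrightarrow> (\<forall>x y. L x \<bullet> y = - (x \<bullet> L y))" for L :: "'b \<Rightarrow>\<^sub>L 'b"
    by (simp add: skew_symmetric_def bounded_linear.linear blinfun.bounded_linear_right)
  have "subspace K"
    unfolding K_def skew_blinfun
    by (rule subspaceI)
      (auto simp: blinfun.add_left blinfun.scaleR_left inner_add_left inner_add_right
        linear_0[OF lin] linear_add[OF lin] linear_scale[OF lin])
  then obtain B where B: "finite B" "span B = K"
  proof -
    obtain F :: "('b \<Rightarrow>\<^sub>L 'b) set" where F: "finite F" "span F = UNIV" by (rule finite_span_blinfun)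
    obtain B where "B \<subseteq> K" "independent B" "K \<subseteq> span B" by (rule maximal_independent_subset)
    moreover have "finite B" using independent_span_bound[OF F(1) \<open>independent B\<close>] F(2) by simp
    moreover have "span B \<subseteq> K" using \<open>B \<subseteq> K\<close> \<open>subspace K\<close> by (rule span_minimal)
    ultimately show ?thesis using that by blast
  qed
  have lin_eval: "linear (\<lambda>L::'b \<Rightarrow>\<^sub>L 'b. L x)" for x
    by (simp add: bounded_linear.linear blinfun.bounded_linear_left)
  \<comment> \<open>A symmetric nontrivial motion, minus its projection to the motions from
    \<open>K\<close>, is nonzero and can be normalised.\<close>
  have "\<exists>g. spherical_motion V E (Q (r n)) g \<and> spherical_symmetric \<Gamma> \<theta> \<rho> V g \<and>
      (\<Sum>i\<in>V. g i \<bullet> g i) = 1 \<and> (\<forall>L\<in>K. (\<Sum>i\<in>V. g i \<bullet> L (Q (r n) i)) = 0)" for n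
  proof -
    let ?q = "Q (r n)"
    obtain f where f: "spherical_motion V E ?q f" "spherical_symmetric \<Gamma> \<theta> \<rho> V f"
      "\<not> spherical_trivial_motion V ?q f"
      using r(2) unfolding spherical_forced_rigid_def by blast
    obtain M where M: "M \<in> K" "\<And>L. L \<in> K \<Longrightarrow> (\<Sum>i\<in>V. (f i - M (?q i)) \<bullet> L (?q i)) = 0"
      using exists_orthogonal_projection[of V "\<lambda>i (L :: 'b \<Rightarrow>\<^sub>L 'b). L (?q i)" B f] \<open>finite V\<close> lin_eval B by auto
    define c where "c = (\<Sum>i\<in>V. (f i - M (?q i)) \<bullet> (f i - M (?q i)))"
    have "c \<noteq> 0"
    proof
      assume "c = 0"
      then have "\<forall>i\<in>V. f i = M (?q i)"
        unfolding c_def by (simp add: sum_nonneg_eq_0_iff \<open>finite V\<close>)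
      then show False using f(3) M(1) by (auto simp: spherical_trivial_motion_def K_def)
    qed
    moreover have "c \<ge> 0" unfolding c_def by (simp add: sum_nonneg)
    ultimately have c: "c > 0" by simp
    define g where "g i = (1 / sqrt c) *\<^sub>R (f i - M (?q i))" for i
    have "spherical_motion V E ?q g"
      unfolding g_def using f(1) M(1)
      by (intro spherical_motion_scaled_diff spherical_motion_skew_symmetric) (auto simp: K_def)
    moreover have "spherical_symmetric \<Gamma> \<theta> \<rho> V g"
      using f(2) symQ[of "r n"] M(1)
      by (simp add: spherical_symmetric_def g_def linear_scale[OF lin] linear_diff[OF lin] K_def)
    moreover have "(\<Sum>i\<in>V. g i \<bullet> g i) = 1"
    proof -
      have "(\<Sum>i\<in>V. g i \<bullet> g i) = (1 / sqrt c) * (1 / sqrt c) * c"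
        unfolding g_def by (simp add: sum_distrib_left c_def)
      then show ?thesis using c by (simp add: field_simps)
    qed
    moreover have "(\<Sum>i\<in>V. g i \<bullet> L (?q i)) = 0" if "L \<in> K" for L
      using M(2)[OF that] by (simp add: g_def flip: sum_divide_distrib)
    ultimately show ?thesis by blast
  qed
  then obtain g where g: "\<And>n. spherical_motion V E (Q (r n)) (g n)"
    "\<And>n. spherical_symmetric \<Gamma> \<theta> \<rho> V (g n)" "\<And>n. (\<Sum>i\<in>V. g n i \<bullet> g n i) = 1"
    "\<And>n L. L \<in> K \<Longrightarrow> (\<Sum>i\<in>V. g n i \<bullet> L (Q (r n) i)) = 0" by metis
  have "norm (g n i) \<le> 1" if "i \<in> V" for n i
  proof -
    have "g n i \<bullet> g n i \<le> (\<Sum>i\<in>V. g n i \<bullet> g n i)"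
      using that \<open>finite V\<close> by (intro member_le_sum) auto
    then show ?thesis using g(3) by (simp add: norm_eq_sqrt_inner)
  qed
  then have "bounded (range (\<lambda>n. g n i))" if "i \<in> V" for i
    using that by (auto simp: bounded_iff)
  then obtain h s where s: "strict_mono (s :: nat \<Rightarrow> nat)"
    and h: "\<And>i. i \<in> V \<Longrightarrow> (\<lambda>n. g (s n) i) \<longlonglongrightarrow> h i"
    using bounded_family_convergent_subseq[of V g] \<open>finite V\<close> by blast
  have q: "(\<lambda>n. Q (r (s n)) i) \<longlonglongrightarrow> q i" if i: "i \<in> V" for i
    using LIMSEQ_subseq_LIMSEQ[OF lim[OF i] strict_mono_o[OF r(1) s(1)]] by (simp add: o_def)
  have "spherical_motion V E q h"
    unfolding spherical_motion_def
  proof (intro conjI ballI impI)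
    fix i j assume ij: "i \<in> V" "j \<in> V" "{i, j} \<in> E"
    have "(\<lambda>n. Q (r (s n)) i \<bullet> g (s n) j + Q (r (s n)) j \<bullet> g (s n) i) \<longlonglongrightarrow> q i \<bullet> h j + q j \<bullet> h i"
      using ij by (intro tendsto_intros q h)
    moreover have "Q (r (s n)) i \<bullet> g (s n) j + Q (r (s n)) j \<bullet> g (s n) i = 0" for n
      using g(1)[of "s n"] ij by (simp add: spherical_motion_def)
    ultimately show "q i \<bullet> h j + q j \<bullet> h i = 0" by (simp add: LIMSEQ_const_iff)
  next
    fix i assume i: "i \<in> V"
    have "(\<lambda>n. Q (r (s n)) i \<bullet> g (s n) i) \<longlonglongrightarrow> q i \<bullet> h i"
      using i by (intro tendsto_intros q h)
    moreover have "Q (r (s n)) i \<bullet> g (s n) i = 0" for n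
      using g(1)[of "s n"] i by (simp add: spherical_motion_def)
    ultimately show "q i \<bullet> h i = 0" by (simp add: LIMSEQ_const_iff)
  qed
  moreover have symh: "spherical_symmetric \<Gamma> \<theta> \<rho> V h"
    unfolding spherical_symmetric_def
  proof (intro ballI)
    fix \<gamma> i assume \<gamma>: "\<gamma> \<in> carrier \<Gamma>" and i: "i \<in> V"
    have "bounded_linear (\<rho> \<gamma>)" using lin[OF \<gamma>] by (simp add: linear_conv_bounded_linear)
    from bounded_linear.tendsto[OF this h[OF i]]
    have "(\<lambda>n. g (s n) (\<theta> \<gamma> i)) \<longlonglongrightarrow> \<rho> \<gamma> (h i)"
      using g(2) \<gamma> i by (simp add: spherical_symmetric_def)
    then show "\<rho> \<gamma> (h i) = h (\<theta> \<gamma> i)"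
      using h[OF \<theta>V[OF \<gamma> i]] LIMSEQ_unique by blast
  qed
  ultimately have "spherical_trivial_motion V q h"
    using rigid unfolding spherical_forced_rigid_def by blast
  then obtain S where S: "skew_symmetric S" "\<And>i. i \<in> V \<Longrightarrow> h i = S (q i)"
    by (auto simp: spherical_trivial_motion_def)
  have linS: "linear S" using S(1) by (simp add: skew_symmetric_def)
  then have SB: "blinfun_apply (Blinfun S) = S"
    by (simp add: bounded_linear_Blinfun_apply linear_conv_bounded_linear)
  \<comment> \<open>On the spanning vectors both sides are \<open>h (\<theta> \<gamma> i)\<close>,
    by symmetry of \<open>h\<close> on the left and of \<open>q\<close> on the right.\<close>
  have "\<rho> \<gamma> (S x) = S (\<rho> \<gamma> x)" if \<gamma>: "\<gamma> \<in> carrier \<Gamma>" for \<gamma> x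
  proof -
    have "(\<rho> \<gamma> \<circ> S) x = (S \<circ> \<rho> \<gamma>) x"
    proof (rule linear_eq_on_span[of "\<rho> \<gamma> \<circ> S" "S \<circ> \<rho> \<gamma>" "q ` V"])
      show "linear (\<rho> \<gamma> \<circ> S)" "linear (S \<circ> \<rho> \<gamma>)"
        using linear_compose linS lin[OF \<gamma>] by blast+
      show "x \<in> span (q ` V)" using span by simp
      show "(\<rho> \<gamma> \<circ> S) y = (S \<circ> \<rho> \<gamma>) y" if "y \<in> q ` V" for y
        using that symh symq \<gamma> S(2) \<theta>V[OF \<gamma>] by (auto simp: spherical_symmetric_def)
    qed
    then show ?thesis by simp
  qed
  then have K: "Blinfun S \<in> K" using S(1) by (simp add: K_def SB)
  \<comment> \<open>Every term of this sequence is 0, and its limit is the squared norm of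
    \<open>h\<close>, because \<open>S (q i) = h i\<close>.\<close>
  have "(\<lambda>n. \<Sum>i\<in>V. g (s n) i \<bullet> Blinfun S (Q (r (s n)) i)) \<longlonglongrightarrow> (\<Sum>i\<in>V. h i \<bullet> Blinfun S (q i))"
    by (intro tendsto_intros q h)
  then have "(\<Sum>i\<in>V. h i \<bullet> h i) = 0"
    using g(4)[OF K] S(2) by (simp add: LIMSEQ_const_iff SB)
  moreover have "(\<lambda>n. \<Sum>i\<in>V. g (s n) i \<bullet> g (s n) i) \<longlonglongrightarrow> (\<Sum>i\<in>V. h i \<bullet> h i)"
    by (intro tendsto_intros h)
  then have "(\<Sum>i\<in>V. h i \<bullet> h i) = 1" using g(3) by (simp add: LIMSEQ_const_iff)
  ultimately show False by simp
qed

section \<open>The equivalence\<close>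

text \<open>Fix a representative in each orbit. By freeness a unique group element
  \<open>t j\<close> carries it to \<open>j\<close>, and the sign that \<open>\<sigma>\<close>
  assigns to this transport is \<open>\<epsilon> j\<close>. The cocycle rule for
  \<open>\<gamma>\<close> after \<open>t j\<close> is then the required relation.\<close>

lemma free_action_sign_coboundary:
  fixes \<sigma> :: "'g \<Rightarrow> 'v \<Rightarrow> real"
  assumes "group \<Gamma>"
    and \<theta>X: "\<And>\<gamma> j. \<gamma> \<in> carrier \<Gamma> \<Longrightarrow> j \<in> X \<Longrightarrow> \<theta> \<gamma> j \<in> X"
    and one: "\<And>j. j \<in> X \<Longrightarrow> \<theta> \<one>\<^bsub>\<Gamma>\<^esub> j = j"
    and mult: "\<And>\<gamma> \<delta> j. \<gamma> \<in> carrier \<Gamma> \<Longrightarrow> \<delta> \<in> carrier \<Gamma> \<Longrightarrow> j \<in> X \<Longrightarrow> \<theta> (\<gamma> \<otimes>\<^bsub>\<Gamma>\<^esub> \<delta>) j = \<theta> \<gamma> (\<theta> \<delta> j)"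
    and free: "\<And>\<gamma> j. \<gamma> \<in> carrier \<Gamma> \<Longrightarrow> j \<in> X \<Longrightarrow> \<theta> \<gamma> j = j \<Longrightarrow> \<gamma> = \<one>\<^bsub>\<Gamma>\<^esub>"
    and sign: "\<And>\<gamma> j. \<gamma> \<in> carrier \<Gamma> \<Longrightarrow> j \<in> X \<Longrightarrow> \<sigma> \<gamma> j \<in> {1, -1}"
    and cocycle: "\<And>\<gamma> \<delta> j. \<gamma> \<in> carrier \<Gamma> \<Longrightarrow> \<delta> \<in> carrier \<Gamma> \<Longrightarrow> j \<in> X \<Longrightarrow>
      \<sigma> (\<gamma> \<otimes>\<^bsub>\<Gamma>\<^esub> \<delta>) j = \<sigma> \<gamma> (\<theta> \<delta> j) * \<sigma> \<delta> j"
  obtains \<epsilon> :: "'v \<Rightarrow> real" where "\<And>j. j \<in> X \<Longrightarrow> \<epsilon> j \<in> {1, -1}"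
    "\<And>\<gamma> j. \<gamma> \<in> carrier \<Gamma> \<Longrightarrow> j \<in> X \<Longrightarrow> \<epsilon> (\<theta> \<gamma> j) = \<sigma> \<gamma> j * \<epsilon> j"
proof -
  interpret group \<Gamma> by fact
  define orb where "orb j = (\<lambda>\<gamma>. \<theta> \<gamma> j) ` carrier \<Gamma>" for j
  \<comment> \<open>The choice depends on the orbit as a set only, so equal orbits get the same
    representative.\<close>
  define rep where "rep j = (SOME k. k \<in> orb j)" for j
  have orb: "orb (\<theta> \<gamma> j) = orb j" if \<gamma>: "\<gamma> \<in> carrier \<Gamma>" and j: "j \<in> X" for \<gamma> j
  proof -
    have "\<theta> \<delta> (\<theta> \<gamma> j) \<in> orb j" if "\<delta> \<in> carrier \<Gamma>" for \<delta>
      using that \<gamma> j unfolding orb_def by (auto intro!: image_eqI[of _ _ "\<delta> \<otimes>\<^bsub>\<Gamma>\<^esub> \<gamma>"] simp: mult)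
    moreover have "\<theta> \<delta> j \<in> orb (\<theta> \<gamma> j)" if "\<delta> \<in> carrier \<Gamma>" for \<delta>
      using that \<gamma> j unfolding orb_def
      by (intro image_eqI[of _ _ "\<delta> \<otimes>\<^bsub>\<Gamma>\<^esub> inv\<^bsub>\<Gamma>\<^esub> \<gamma>"]) (auto simp: m_assoc simp flip: mult)
    ultimately show ?thesis by (auto simp: orb_def)
  qed
  have rep: "\<exists>\<gamma>\<in>carrier \<Gamma>. \<theta> \<gamma> (rep j) = j" and repX: "rep j \<in> X" if j: "j \<in> X" for j
  proof -
    have "rep j \<in> orb j" unfolding rep_def by (rule someI_ex) (auto simp: orb_def)
    then obtain \<gamma> where \<gamma>: "\<gamma> \<in> carrier \<Gamma>" "rep j = \<theta> \<gamma> j" by (auto simp: orb_def)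
    then show "rep j \<in> X" using \<theta>X j by simp
    have "\<theta> (inv\<^bsub>\<Gamma>\<^esub> \<gamma>) (rep j) = j" using \<gamma> j by (simp add: one flip: mult)
    then show "\<exists>\<gamma>\<in>carrier \<Gamma>. \<theta> \<gamma> (rep j) = j" using \<gamma>(1) by blast
  qed
  then obtain t where t: "\<And>j. j \<in> X \<Longrightarrow> t j \<in> carrier \<Gamma>" "\<And>j. j \<in> X \<Longrightarrow> \<theta> (t j) (rep j) = j" by metis
  have uniq: "\<gamma> = \<delta>" if "\<gamma> \<in> carrier \<Gamma>" "\<delta> \<in> carrier \<Gamma>" "j \<in> X" "\<theta> \<gamma> j = \<theta> \<delta> j" for \<gamma> \<delta> j
  proof -
    have "\<theta> (inv\<^bsub>\<Gamma>\<^esub> \<delta> \<otimes>\<^bsub>\<Gamma>\<^esub> \<gamma>) j = \<theta> (inv\<^bsub>\<Gamma>\<^esub> \<delta> \<otimes>\<^bsub>\<Gamma>\<^esub> \<delta>) j" using that by (simp only: mult inv_closed)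
    then have "inv\<^bsub>\<Gamma>\<^esub> \<delta> \<otimes>\<^bsub>\<Gamma>\<^esub> \<gamma> = \<one>\<^bsub>\<Gamma>\<^esub>" using that by (intro free[of _ j]) (auto simp: one)
    then show ?thesis using that by (metis inv_closed inv_equality inv_inv)
  qed
  show ?thesis
  proof (rule that[of "\<lambda>j. \<sigma> (t j) (rep j)"])
    fix j assume "j \<in> X"
    then show "\<sigma> (t j) (rep j) \<in> {1, -1}" using sign t repX by blast
  next
    fix \<gamma> j assume \<gamma>: "\<gamma> \<in> carrier \<Gamma>" and j: "j \<in> X"
    have same: "rep (\<theta> \<gamma> j) = rep j" using orb[OF \<gamma> j] by (simp add: rep_def)
    have "t (\<theta> \<gamma> j) = \<gamma> \<otimes>\<^bsub>\<Gamma>\<^esub> t j"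
      using t[OF j] t[OF \<theta>X[OF \<gamma> j]] \<gamma> repX[OF j] by (intro uniq[of _ _ "rep j"]) (auto simp: same mult)
    then show "\<sigma> (t (\<theta> \<gamma> j)) (rep (\<theta> \<gamma> j)) = \<sigma> \<gamma> j * \<sigma> (t j) (rep j)"
      using cocycle[OF \<gamma> t(1)[OF j] repX[OF j]] t(2)[OF j] same by simp
  qed
qed

lemma spherical_forced_rigid_cong:
  assumes "\<And>i. i \<in> V \<Longrightarrow> q i = s i"
  shows "spherical_forced_rigid \<Gamma> \<theta> \<rho> V E q \<longleftrightarrow> spherical_forced_rigid \<Gamma> \<theta> \<rho> V E s"
  unfolding spherical_forced_rigid_def spherical_motion_def spherical_trivial_motion_def
  using assms by simp

lemma graph_action:
  assumes "group \<Gamma>" and hom: "\<theta> \<in> hom \<Gamma> (graph_aut V E)"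
  shows graph_action_bij: "\<And>\<gamma>. \<gamma> \<in> carrier \<Gamma> \<Longrightarrow> bij_betw (\<theta> \<gamma>) V V"
    and graph_action_mult: "\<And>\<gamma> \<delta> i. \<gamma> \<in> carrier \<Gamma> \<Longrightarrow> \<delta> \<in> carrier \<Gamma> \<Longrightarrow> i \<in> V \<Longrightarrow>
      \<theta> (\<gamma> \<otimes>\<^bsub>\<Gamma>\<^esub> \<delta>) i = \<theta> \<gamma> (\<theta> \<delta> i)"
    and graph_action_one: "\<And>i. i \<in> V \<Longrightarrow> \<theta> \<one>\<^bsub>\<Gamma>\<^esub> i = i"
proof -
  interpret group \<Gamma> by fact
  have Bij: "\<theta> \<gamma> \<in> Bij V" if "\<gamma> \<in> carrier \<Gamma>" for \<gamma>
    using hom_in_carrier[OF hom that] by (simp add: graph_aut_def)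
  then show bij: "bij_betw (\<theta> \<gamma>) V V" if "\<gamma> \<in> carrier \<Gamma>" for \<gamma>
    using that by (simp add: Bij_def)
  show mult: "\<theta> (\<gamma> \<otimes>\<^bsub>\<Gamma>\<^esub> \<delta>) i = \<theta> \<gamma> (\<theta> \<delta> i)"
    if "\<gamma> \<in> carrier \<Gamma>" "\<delta> \<in> carrier \<Gamma>" "i \<in> V" for \<gamma> \<delta> i
    using hom_mult[OF hom that(1,2)] Bij that
    by (simp add: graph_aut_def BijGroup_def compose_def)
  show "\<theta> \<one>\<^bsub>\<Gamma>\<^esub> i = i" if i: "i \<in> V" for i
  proof -
    \<comment> \<open>The unit acts as an idempotent, and an injective idempotent is the
      identity.\<close>
    have "\<theta> \<one>\<^bsub>\<Gamma>\<^esub> (\<theta> \<one>\<^bsub>\<Gamma>\<^esub> i) = \<theta> \<one>\<^bsub>\<Gamma>\<^esub> i" using mult[of "\<one>\<^bsub>\<Gamma>\<^esub>" "\<one>\<^bsub>\<Gamma>\<^esub>" i] i by simp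
    then show ?thesis
      using bij[OF one_closed] i by (auto simp: bij_betw_def inj_on_def)
  qed
qed

theorem theorem4p2:
  fixes \<Gamma> :: "('g, 'm) monoid_scheme"
    and V X :: "'v set"
    and E :: "'v set set"
    and \<theta> :: "'g \<Rightarrow> 'v \<Rightarrow> 'v"
    and \<tau> :: "'g \<Rightarrow> real ^ 'd \<Rightarrow> real ^ 'd"
  assumes "group \<Gamma>"
    and "finite_graph V E"
    and "\<theta> \<in> hom \<Gamma> (graph_aut V E)"
    and "acts_freely \<Gamma> \<theta> V"
    and "X \<subseteq> V"
    and "\<And>\<gamma>. \<gamma> \<in> carrier \<Gamma> \<Longrightarrow> \<theta> \<gamma> ` X = X"
    and "\<tau> \<in> hom \<Gamma> orthogonal_group"
  shows "(\<exists>q :: 'v \<Rightarrow> (real ^ 'd) \<times> real.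
            spherical_framework V q \<and>
            spherical_symmetric \<Gamma> \<theta> (augmented_rep \<tau>) V q \<and>
            spherical_forced_rigid \<Gamma> \<theta> (augmented_rep \<tau>) V E q \<and>
            q ` X \<subseteq> equator)
     \<longleftrightarrow>
         (\<exists>(p :: 'v \<Rightarrow> real ^ 'd) (a :: 'v \<Rightarrow> real ^ 'd) (r :: 'v \<Rightarrow> real) (\<sigma> :: 'g \<Rightarrow> 'v \<Rightarrow> real).
            ph_framework (V - X) X p a r \<and>
            ph_symmetric \<Gamma> \<theta> \<tau> \<sigma> (V - X) X p a r \<and>
            ph_forced_rigid \<Gamma> \<theta> \<tau> \<sigma> (V - X) X E p a)"
    (is "?spherical \<longleftrightarrow> ?ph")
proof -
  interpret group \<Gamma> by fact
  note bij = graph_action_bij[OF assms(1,3)] and mult = graph_action_mult[OF assms(1,3)]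
    and one = graph_action_one[OF assms(1,3)]
  have "finite V" using assms(2) by (simp add: finite_graph_def)
  have \<theta>V: "\<theta> \<gamma> i \<in> V" if "\<gamma> \<in> carrier \<Gamma>" "i \<in> V" for \<gamma> i
    using bij[OF that(1)] that(2) by (rule bij_betwE[THEN bspec])
  have \<theta>X: "\<theta> \<gamma> i \<in> X \<longleftrightarrow> i \<in> X" if "\<gamma> \<in> carrier \<Gamma>" "i \<in> V" for \<gamma> i
    using inj_on_image_mem_iff[OF bij_betw_imp_inj_on[OF bij[OF that(1)]] that(2) assms(5)]
      assms(6)[OF that(1)] by simp
  have XV: "i \<in> V" if "i \<in> X" for i using assms(5) that by blast
  have \<tau>: "orthogonal_transformation (\<tau> \<gamma>)" if "\<gamma> \<in> carrier \<Gamma>" for \<gamma>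
    using hom_in_carrier[OF assms(7) that] by (simp add: orthogonal_group_def)
  then have lin: "linear (\<tau> \<gamma>)" and norm_\<tau>: "norm (\<tau> \<gamma> x) = norm x" if "\<gamma> \<in> carrier \<Gamma>" for \<gamma> x
    using that by (auto simp: orthogonal_transformation)
  have \<tau>_mult: "\<tau> (\<gamma> \<otimes>\<^bsub>\<Gamma>\<^esub> \<delta>) x = \<tau> \<gamma> (\<tau> \<delta> x)" if "\<gamma> \<in> carrier \<Gamma>" "\<delta> \<in> carrier \<Gamma>" for \<gamma> \<delta> x
    using hom_mult[OF assms(7) that] by (simp add: orthogonal_group_def)
  show ?thesis
  proof
    assume ?spherical
    then obtain q where fw: "spherical_framework V q"
      and sym: "spherical_symmetric \<Gamma> \<theta> (augmented_rep \<tau>) V q"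
      and rigid: "spherical_forced_rigid \<Gamma> \<theta> (augmented_rep \<tau>) V E q"
      and eq: "q ` X \<subseteq> equator" by blast
    have span: "span (q ` V) = UNIV" using fw by (simp add: spherical_framework_def)
    \<comment> \<open>The shift is fixed by the augmented representation and \<open>X\<close> is
      invariant, so symmetry survives. The vectors leave the sphere, which the weights of the cone
      later account for.\<close>
    define Q where "Q n i = (if i \<in> X then q i else q i + (0, 1 / real (Suc n)))" for n i
    have lim: "(\<lambda>n. Q n i) \<longlonglongrightarrow> q i" for i
    proof -
      have "(\<lambda>n. q i + (0, 1 / real (Suc n))) \<longlonglongrightarrow> q i + (0, 0)"
        by (intro tendsto_intros LIMSEQ_Suc lim_1_over_n)
      then show ?thesis by (cases "i \<in> X") (simp_all add: Q_def flip: zero_prod_def)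
    qed
    have linA: "linear (augmented_rep \<tau> \<gamma>)" if "\<gamma> \<in> carrier \<Gamma>" for \<gamma>
      using lin[OF that]
      by (intro linearI) (auto simp: augmented_rep_def linear_add linear_scale)
    have symQ: "spherical_symmetric \<Gamma> \<theta> (augmented_rep \<tau>) V (Q n)" for n
      unfolding spherical_symmetric_def
    proof (intro ballI)
      fix \<gamma> i assume \<gamma>: "\<gamma> \<in> carrier \<Gamma>" and i: "i \<in> V"
      have "augmented_rep \<tau> \<gamma> (0, s) = (0, s)" for s
        using linear_0[OF lin[OF \<gamma>]] by (simp add: augmented_rep_def)
      moreover have "augmented_rep \<tau> \<gamma> (q i) = q (\<theta> \<gamma> i)"
        using sym \<gamma> i by (simp add: spherical_symmetric_def)
      ultimately show "augmented_rep \<tau> \<gamma> (Q n i) = Q n (\<theta> \<gamma> i)"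
        using \<theta>X[OF \<gamma> i] by (simp add: Q_def linear_add[OF linA[OF \<gamma>]])
    qed
    have "\<forall>\<^sub>F n in sequentially. spherical_forced_rigid \<Gamma> \<theta> (augmented_rep \<tau>) V E (Q n)"
      using \<open>finite V\<close> linA \<theta>V lim span symQ sym rigid by (rule eventually_spherical_forced_rigid)
    moreover have "\<forall>\<^sub>F n in sequentially. span (Q n ` V) = UNIV"
      using lim span by (rule eventually_span_eq_UNIV)
    moreover have "\<forall>\<^sub>F n in sequentially. \<forall>i\<in>V - X. snd (Q n i) \<noteq> 0"
    proof (intro eventually_ball_finite ballI)
      fix i assume i: "i \<in> V - X"
      show "\<forall>\<^sub>F n in sequentially. snd (Q n i) \<noteq> 0"
      \<comment> \<open>A vertex on the equator has last coordinate \<open>1 / real (Suc n)\<close>,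
        nonzero for every \<open>n\<close>; any other has a nonzero limit.\<close>
      proof (cases "snd (q i) = 0")
        case True
        then show ?thesis using i by (simp add: Q_def)
      next
        case False
        show ?thesis using tendsto_snd[OF lim] False by (rule tendsto_imp_eventually_ne)
      qed
    qed (use \<open>finite V\<close> in simp)
    ultimately have "\<forall>\<^sub>F n in sequentially. spherical_forced_rigid \<Gamma> \<theta> (augmented_rep \<tau>) V E (Q n) \<and>
        span (Q n ` V) = UNIV \<and> (\<forall>i\<in>V - X. snd (Q n i) \<noteq> 0)"
      by (intro eventually_conj)
    from eventually_happens'[OF sequentially_bot this]
    obtain n where n: "spherical_forced_rigid \<Gamma> \<theta> (augmented_rep \<tau>) V E (Q n)"
      "span (Q n ` V) = UNIV" "\<And>i. i \<in> V - X \<Longrightarrow> snd (Q n i) \<noteq> 0" by blast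
    \<comment> \<open>Dividing by the last coordinate, which may be negative, moves each vertex
      outside \<open>X\<close> to height 1, where \<open>p\<close> is read off.\<close>
    define w where "w i = (if i \<in> X then 1 else snd (Q n i))" for i
    define p where "p i = (1 / w i) *\<^sub>R fst (Q n i)" for i
    define a where "a i = fst (q i)" for i
    have w: "w i \<noteq> 0" if "i \<in> V" for i using n(3) that by (simp add: w_def)
    have qX: "snd (q j) = 0" "norm (q j) = 1" if "j \<in> X" for j
      using eq that by (auto simp: equator_def)
    have cone: "Q n i = cone_point X w p a i" if "i \<in> V" for i
      using w[OF that] qX[of i]
      by (auto simp: cone_point_def p_def a_def w_def Q_def prod_eq_iff split: if_splits)
    have equi: "\<tau> \<gamma> (fst (Q n i)) = fst (Q n (\<theta> \<gamma> i))" "snd (Q n (\<theta> \<gamma> i)) = snd (Q n i)"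
      if "\<gamma> \<in> carrier \<Gamma>" "i \<in> V" for \<gamma> i
    proof -
      have "augmented_rep \<tau> \<gamma> (Q n i) = Q n (\<theta> \<gamma> i)"
        using symQ[of n] that by (simp add: spherical_symmetric_def)
      then show "\<tau> \<gamma> (fst (Q n i)) = fst (Q n (\<theta> \<gamma> i))" "snd (Q n (\<theta> \<gamma> i)) = snd (Q n i)"
        by (simp_all add: augmented_rep_def prod_eq_iff)
    qed
    have wP: "w (\<theta> \<gamma> i) = w i" if "\<gamma> \<in> carrier \<Gamma>" "i \<in> V" for \<gamma> i
      using equi(2)[OF that] \<theta>X[OF that] by (simp add: w_def)
    have p: "\<tau> \<gamma> (p i) = p (\<theta> \<gamma> i)" if "\<gamma> \<in> carrier \<Gamma>" "i \<in> V" for \<gamma> i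
      using equi(1)[OF that] wP[OF that] by (simp add: p_def linear_scale[OF lin[OF that(1)]])
    have a: "\<tau> \<gamma> (a j) = a (\<theta> \<gamma> j)" if "\<gamma> \<in> carrier \<Gamma>" "j \<in> X" for \<gamma> j
      using equi(1)[OF that(1) XV[OF that(2)]] \<theta>X[OF that(1) XV[OF that(2)]] that(2)
      by (simp add: Q_def a_def)
    have "norm (a j) = 1" if "j \<in> X" for j
      using qX[OF that] by (simp add: a_def norm_prod_def)
    moreover have "span (cone_point X w p a ` V) = UNIV"
      using n(2) cone by (simp cong: image_cong)
    \<comment> \<open>All hyperplanes are taken through the origin. With offset 0 and sign 1, the
      symmetry relations on \<open>X\<close> reduce to equivariance of the normals.\<close>
    ultimately have "ph_framework (V - X) X p a (\<lambda>_. 0)"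
      unfolding ph_framework_def using span_cone_eq_UNIV_iff[of X V w p a] assms(5) w by simp
    moreover have "ph_symmetric \<Gamma> \<theta> \<tau> (\<lambda>_ _. 1) (V - X) X p a (\<lambda>_. 0)"
      unfolding ph_symmetric_def using p a by simp
    moreover have "ph_forced_rigid \<Gamma> \<theta> \<tau> (\<lambda>_ _. 1) (V - X) X E p a"
    proof -
      have "spherical_forced_rigid \<Gamma> \<theta> (augmented_rep \<tau>) V E (cone_point X w p a)
          \<longleftrightarrow> ph_forced_rigid \<Gamma> \<theta> \<tau> (\<lambda>_ _. 1) (V - X) X E p a"
      proof (rule forced_rigid_cone_iff[where \<Gamma> = \<Gamma> and \<tau> = \<tau> and \<theta> = \<theta> and \<sigma> = "\<lambda>_ _. 1"])
        fix \<gamma> i assume \<gamma>: "\<gamma> \<in> carrier \<Gamma>" and i: "i \<in> V - X"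
        then have "i \<in> V" by simp
        show "\<tau> \<gamma> (p i) = p (\<theta> \<gamma> i)" by (rule p) fact+
        show "w (\<theta> \<gamma> i) = w i" by (rule wP) fact+
      next
        fix \<gamma> j assume \<gamma>: "\<gamma> \<in> carrier \<Gamma>" and j: "j \<in> X"
        show "w (\<theta> \<gamma> j) = 1 * w j" using wP[OF \<gamma> XV[OF j]] by simp
      qed (fact assms(5) w \<tau> \<theta>V \<theta>X | simp)+
      moreover have "spherical_forced_rigid \<Gamma> \<theta> (augmented_rep \<tau>) V E (Q n) \<longleftrightarrow>
          spherical_forced_rigid \<Gamma> \<theta> (augmented_rep \<tau>) V E (cone_point X w p a)"
        using cone by (rule spherical_forced_rigid_cong)
      ultimately show ?thesis using n(1) by simp
    qed
    ultimately show ?ph by (intro exI conjI)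
  next
    assume ?ph
    then obtain p a r \<sigma> where fw: "ph_framework (V - X) X p a r"
      and sym: "ph_symmetric \<Gamma> \<theta> \<tau> \<sigma> (V - X) X p a r"
      and rigid: "ph_forced_rigid \<Gamma> \<theta> \<tau> \<sigma> (V - X) X E p a" by blast
    have norm_a: "norm (a j) = 1" if "j \<in> X" for j using fw that by (simp add: ph_framework_def)
    have p: "\<tau> \<gamma> (p i) = p (\<theta> \<gamma> i)" if "\<gamma> \<in> carrier \<Gamma>" "i \<in> V - X" for \<gamma> i
      using sym that by (simp add: ph_symmetric_def)
    have \<sigma>: "\<sigma> \<gamma> j \<in> {1, -1}" and a: "\<tau> \<gamma> (a j) = \<sigma> \<gamma> j *\<^sub>R a (\<theta> \<gamma> j)"
      if "\<gamma> \<in> carrier \<Gamma>" "j \<in> X" for \<gamma> j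
      using sym that by (auto simp: ph_symmetric_def)
    have cocycle: "\<sigma> (\<gamma> \<otimes>\<^bsub>\<Gamma>\<^esub> \<delta>) j = \<sigma> \<gamma> (\<theta> \<delta> j) * \<sigma> \<delta> j"
      if \<gamma>: "\<gamma> \<in> carrier \<Gamma>" and \<delta>: "\<delta> \<in> carrier \<Gamma>" and j: "j \<in> X" for \<gamma> \<delta> j
    proof -
      have X: "\<theta> \<delta> j \<in> X" "\<theta> \<gamma> (\<theta> \<delta> j) \<in> X"
        using \<theta>X \<theta>V \<gamma> \<delta> j XV by auto
      have "\<sigma> (\<gamma> \<otimes>\<^bsub>\<Gamma>\<^esub> \<delta>) j *\<^sub>R a (\<theta> \<gamma> (\<theta> \<delta> j)) = \<tau> (\<gamma> \<otimes>\<^bsub>\<Gamma>\<^esub> \<delta>) (a j)"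
        using a[of "\<gamma> \<otimes>\<^bsub>\<Gamma>\<^esub> \<delta>" j] \<gamma> \<delta> j by (simp add: mult XV)
      also have "\<dots> = (\<sigma> \<gamma> (\<theta> \<delta> j) * \<sigma> \<delta> j) *\<^sub>R a (\<theta> \<gamma> (\<theta> \<delta> j))"
        using \<tau>_mult[OF \<gamma> \<delta>] a[OF \<delta> j] a[OF \<gamma> X(1)] by (simp add: linear_scale[OF lin[OF \<gamma>]])
      finally show ?thesis using norm_a[OF X(2)] by auto
    qed
    have free: "\<gamma> = \<one>\<^bsub>\<Gamma>\<^esub>" if "\<gamma> \<in> carrier \<Gamma>" "j \<in> X" "\<theta> \<gamma> j = j" for \<gamma> j
      using assms(4) that XV by (auto simp: acts_freely_def)
    obtain \<epsilon> :: "'v \<Rightarrow> real" where \<epsilon>: "\<And>j. j \<in> X \<Longrightarrow> \<epsilon> j \<in> {1, -1}"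
      "\<And>\<gamma> j. \<gamma> \<in> carrier \<Gamma> \<Longrightarrow> j \<in> X \<Longrightarrow> \<epsilon> (\<theta> \<gamma> j) = \<sigma> \<gamma> j * \<epsilon> j"
      by (rule free_action_sign_coboundary[of \<Gamma> X \<theta> \<sigma>])
        (use assms(1) \<theta>X one mult free \<sigma> cocycle XV in auto)
    \<comment> \<open>On points the weight normalises \<open>(p i, 1)\<close> and is constant on
      orbits, as \<open>\<tau> \<gamma>\<close> is an isometry. On hyperplanes it reorients the
      normals so that \<open>\<sigma>\<close> disappears.\<close>
    define w where "w i = (if i \<in> X then \<epsilon> i else 1 / norm (p i, 1::real))" for i
    have w: "w i \<noteq> 0" if "i \<in> V" for i
      using \<epsilon>(1)[of i] by (auto simp: w_def norm_prod_def add_nonneg_eq_0_iff)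
    have wP: "w (\<theta> \<gamma> i) = w i" if "\<gamma> \<in> carrier \<Gamma>" "i \<in> V - X" for \<gamma> i
      using p[OF that, symmetric] \<theta>X that norm_\<tau>[OF that(1)] by (simp add: w_def norm_prod_def)
    have wH: "w (\<theta> \<gamma> j) = \<sigma> \<gamma> j * w j" if "\<gamma> \<in> carrier \<Gamma>" "j \<in> X" for \<gamma> j
      using \<epsilon>(2)[OF that] \<theta>X XV that by (simp add: w_def)
    let ?q = "cone_point X w p a"
    have "norm (?q i) = 1" if "i \<in> V" for i
    proof (cases "i \<in> X")
      case True
      then show ?thesis using \<epsilon>(1)[OF True] norm_a[OF True]
        by (auto simp: cone_point_def w_def norm_prod_def)
    next
      case False
      then show ?thesis using w[OF that] by (simp add: cone_point_def w_def del: scaleR_Pair)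
    qed
    then have sphere: "?q i \<in> sphere 0 1" if "i \<in> V" for i using that by simp
    have "span (?q ` V) = UNIV"
      using span_cone_eq_UNIV_iff[of X V w p a] assms(5) w fw by (simp add: ph_framework_def)
    with sphere have "spherical_framework V ?q" by (simp add: spherical_framework_def)
    moreover have "spherical_symmetric \<Gamma> \<theta> (augmented_rep \<tau>) V ?q"
      unfolding spherical_symmetric_def
    proof (intro ballI)
      fix \<gamma> i assume \<gamma>: "\<gamma> \<in> carrier \<Gamma>" and i: "i \<in> V"
      show "augmented_rep \<tau> \<gamma> (?q i) = ?q (\<theta> \<gamma> i)"
      proof (cases "i \<in> X")
        case True
        \<comment> \<open>Both sides carry the same factor \<open>\<sigma> \<gamma> i\<close>, on
          the left from the normal and on the right from the weight.\<close>
        then show ?thesis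
          using \<theta>X[OF \<gamma> i] wH[OF \<gamma> True] a[OF \<gamma> True]
          by (simp add: cone_point_def augmented_rep_def linear_scale[OF lin[OF \<gamma>]] mult.commute)
      next
        case False
        then show ?thesis
          using \<theta>X[OF \<gamma> i] wP[of \<gamma> i] p[of \<gamma> i] \<gamma> i
          by (simp add: cone_point_def augmented_rep_def linear_scale[OF lin[OF \<gamma>]])
      qed
    qed
    moreover have "spherical_forced_rigid \<Gamma> \<theta> (augmented_rep \<tau>) V E ?q \<longleftrightarrow>
        ph_forced_rigid \<Gamma> \<theta> \<tau> \<sigma> (V - X) X E p a"
      using assms(5) w \<tau> \<theta>V \<theta>X p wP wH \<sigma> by (rule forced_rigid_cone_iff)
    moreover have "?q ` X \<subseteq> equator"
    proof (intro image_subsetI)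
      fix j assume "j \<in> X"
      then have "snd (?q j) = 0" by (simp add: cone_point_def)
      then show "?q j \<in> equator"
        using sphere[OF XV[OF \<open>j \<in> X\<close>]] by (simp only: equator_def mem_Collect_eq simp_thms)
    qed
    ultimately show ?spherical using rigid by blast
  qed
qed

end
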